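(* If LP1($Z$) is feasible, then Algorithm Assign with the doubling procedure for $\Gamma$ obtains a fractional solution to LP1($Z$) whose cumulative cost over all trials is $O(\ln(mn)\ln(mn\rho))\,OPT_1(Z)$.
   Context: CCFL: facilities $[m]$ ($m\ge2$) with fixed charges $c_i\ge0$ known offline; $n\ge2$ clients arrive online, client $j$ revealing assignment costs $a_{ij}\ge0$ and capacity-normalized demands $p_{ij}\ge0$. $\rho=\max_j\frac{\max_i(c_i+p_{ij}+a_{ij})}{\min_i(c_i+p_{ij}+a_{ij})}$. For $Z>0$ let $F_j(Z)=\{i:c_i+p_{ij}+a_{ij}\le Z\}$. LP1($Z$): $\min\sum_ic_iy_i+Z\lambda+\sum_{i,j}a_{ij}x_{ij}$ s.t. $\sum_ix_{ij}\ge1$, $y_i\ge x_{ij}$, $Zy_i\ge\sum_jp_{ij}x_{ij}$, $\lambda\ge y_i$, $\lambda\ge1$, nonnegativity, and $x_{ij}=0$ for $i\notin F_j(Z)$; $OPT_1(Z)$ is its optimal value. $\mu=1+\frac1{6\ln(emn)}$. Algorithm Assign($Z,\Gamma$): $\tilde w_i(\mathbf{x})=\max_jx_{ij}/\Gamma$, $\tilde v_i(\mathbf{x})=\sum_jp_{ij}x_{ij}/(Z\Gamma)$, $\tilde y_i=\tilde v_i+\tilde w_i$, $\tilde\lambda=\max_i\tilde y_i$; $\Phi(\mathbf{x})=\ln\sum_ie^{\sum_jp_{ij}x_{ij}/(Z\Gamma)}+\ln\sum_{i\in[m],j\in[n]}e^{x_{ij}/\Gamma}$; $\mathrm{cost}(\mathbf{x})=Z\Phi(\mathbf{x})+\sum_ic_i\tilde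 y_i(\mathbf{x})+\sum_{i,j}a_{ij}x_{ij}/\Gamma$; $r_{ij}(\mathbf{x})=Z\partial\Phi/\partial x_{ij}+\frac{c_i}{\Gamma}(\frac{p_{ij}}Z+1_{ij})+\frac{a_{ij}}{\Gamma}$ with $1_{ij}=1$ iff $x_{ij}=\Gamma\tilde w_i(\mathbf{x})$; $\epsilon_j(\mathbf{x})=(\mu-1)\min_ir_{ij}(\mathbf{x})$; $x^0_{ij}=\frac1{2mn}\frac{\min_{i'}(c_{i'}+p_{i'j}+a_{i'j})}{c_i+p_{ij}+a_{ij}}$. Initially all $x_{ij}=0$. When client $j$ arrives: $x_{ij}\leftarrow x^0_{ij}$ for $i\in F_j(Z)$; while $\sum_ix_{ij}<1$: with $\mathbf{x}^l$ current, for each $i\in F_j(Z)$, if $\tilde w_i(\mathbf{x}^l)>x_{ij}/\Gamma$ then $x_{ij}\leftarrow\min\{\Gamma\tilde w_i(\mathbf{x}^l),x_{ij}(1+\epsilon_j(\mathbf{x}^l)/r_{ij}(\mathbf{x}^l))\}$, else $x_{ij}\leftarrow x_{ij}(1+\epsilon_j(\mathbf{x}^l)/r_{ij}(\mathbf{x}^l))$; return FAIL if $\mathrm{cost}(\mathbf{x})>5Z\ln(emn)$. Doubling procedure for $\Gamma$: start with $\Gamma=1$; each execution of Assign with its own fresh variables (with $x_{ij}$ initialized to $x^0_{ij}$ for clients arriving in it) is a trial; when a trial fails, $\Gamma$ is doubled and a new trial with new variables continues with the clients not yet assigned. The cost of trial with parameter $\Gamma$ is $\Gamma$ times the value $\sum_ic_i\tilde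 y_i+Z\tilde\lambda+\sum_{i,j}a_{ij}x_{ij}/\Gamma$ it reaches, and the cumulative cost is the sum of these over all trials. *)

theory Defs
  imports
    "HOL-Analysis.Analysis"
    "HOL-Library.While_Combinator"
    "HOL-Library.Monad_Syntax"
begin

text \<open>Facilities are the numbers below \<open>num_fac\<close>, clients the numbers below \<open>num_cl\<close>, listed in
  order of arrival. In \<open>demand I i j\<close>, \<open>asg I i j\<close> and in an assignment \<open>x i j\<close>, the facility
  \<open>i\<close> comes first.\<close>

record ccfl =
  num_fac :: nat
  num_cl :: nat
  charge :: "nat \<Rightarrow> real"
  demand :: "nat \<Rightarrow> nat \<Rightarrow> real"
  asg :: "nat \<Rightarrow> nat \<Rightarrow> real"

type_synonym assignment = "nat \<Rightarrow> nat \<Rightarrow> real"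

definition total :: "ccfl \<Rightarrow> nat \<Rightarrow> nat \<Rightarrow> real" where
  "total I i j = charge I i + demand I i j + asg I i j"

text \<open>The last condition makes the quotients in \<open>rho\<close> and \<open>x_init\<close> below meaningful.\<close>

definition ccfl_instance :: "ccfl \<Rightarrow> bool" where
  "ccfl_instance I \<longleftrightarrow>
     num_fac I \<ge> 2 \<and> num_cl I \<ge> 2 \<and>
     (\<forall>i<num_fac I. charge I i \<ge> 0) \<and>
     (\<forall>i<num_fac I. \<forall>j<num_cl I. demand I i j \<ge> 0 \<and> asg I i j \<ge> 0) \<and>
     (\<forall>i<num_fac I. \<forall>j<num_cl I. total I i j > 0)"

definition rho :: "ccfl \<Rightarrow> real" where
  "rho I = (MAX j\<in>{..<num_cl I}.
      (MAX i\<in>{..<num_fac I}. total I i j) / (MIN i\<in>{..<num_fac I}. total I i j))"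

definition near :: "ccfl \<Rightarrow> real \<Rightarrow> nat \<Rightarrow> nat set" where
  "near I Z j = {i. i < num_fac I \<and> total I i j \<le> Z}"


subsection \<open>The linear program\<close>

definition lp1_feasible ::
    "ccfl \<Rightarrow> real \<Rightarrow> assignment \<Rightarrow> (nat \<Rightarrow> real) \<Rightarrow> real \<Rightarrow> bool" where
  "lp1_feasible I Z x y l \<longleftrightarrow>
     (\<forall>j<num_cl I. (\<Sum>i<num_fac I. x i j) \<ge> 1) \<and>
     (\<forall>i<num_fac I. \<forall>j<num_cl I. y i \<ge> x i j) \<and>
     (\<forall>i<num_fac I. Z * y i \<ge> (\<Sum>j<num_cl I. demand I i j * x i j)) \<and>
     (\<forall>i<num_fac I. l \<ge> y i) \<and>
     l \<ge> 1 \<and>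
     (\<forall>i<num_fac I. \<forall>j<num_cl I. x i j \<ge> 0) \<and>
     (\<forall>i<num_fac I. y i \<ge> 0) \<and>
     (\<forall>i<num_fac I. \<forall>j<num_cl I. i \<notin> near I Z j \<longrightarrow> x i j = 0)"

definition lp1_objective ::
    "ccfl \<Rightarrow> real \<Rightarrow> assignment \<Rightarrow> (nat \<Rightarrow> real) \<Rightarrow> real \<Rightarrow> real" where
  "lp1_objective I Z x y l =
     (\<Sum>i<num_fac I. charge I i * y i) + Z * l
     + (\<Sum>i<num_fac I. \<Sum>j<num_cl I. asg I i j * x i j)"

definition opt1 :: "ccfl \<Rightarrow> real \<Rightarrow> real" where
  "opt1 I Z = Inf {lp1_objective I Z x y l | x y l. lp1_feasible I Z x y l}"


subsection \<open>Quantities maintained by the algorithm\<close>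

definition log_emn :: "ccfl \<Rightarrow> real" where
  "log_emn I = ln (exp 1 * real (num_fac I) * real (num_cl I))"

definition mu :: "ccfl \<Rightarrow> real" where
  "mu I = 1 + 1 / (6 * log_emn I)"

definition w_til :: "ccfl \<Rightarrow> real \<Rightarrow> assignment \<Rightarrow> nat \<Rightarrow> real" where
  "w_til I \<Gamma> x i = (MAX j\<in>{..<num_cl I}. x i j) / \<Gamma>"

definition v_til :: "ccfl \<Rightarrow> real \<Rightarrow> real \<Rightarrow> assignment \<Rightarrow> nat \<Rightarrow> real" where
  "v_til I Z \<Gamma> x i = (\<Sum>j<num_cl I. demand I i j * x i j) / (Z * \<Gamma>)"

definition y_til :: "ccfl \<Rightarrow> real \<Rightarrow> real \<Rightarrow> assignment \<Rightarrow> nat \<Rightarrow> real" where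
  "y_til I Z \<Gamma> x i = v_til I Z \<Gamma> x i + w_til I \<Gamma> x i"

definition l_til :: "ccfl \<Rightarrow> real \<Rightarrow> real \<Rightarrow> assignment \<Rightarrow> real" where
  "l_til I Z \<Gamma> x = (MAX i\<in>{..<num_fac I}. y_til I Z \<Gamma> x i)"

definition potential :: "ccfl \<Rightarrow> real \<Rightarrow> real \<Rightarrow> assignment \<Rightarrow> real" where
  "potential I Z \<Gamma> x =
     ln (\<Sum>i<num_fac I. exp ((\<Sum>j<num_cl I. demand I i j * x i j) / (Z * \<Gamma>)))
     + ln (\<Sum>i<num_fac I. \<Sum>j<num_cl I. exp (x i j / \<Gamma>))"

definition alg_cost :: "ccfl \<Rightarrow> real \<Rightarrow> real \<Rightarrow> assignment \<Rightarrow> real" where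
  "alg_cost I Z \<Gamma> x =
     Z * potential I Z \<Gamma> x
     + (\<Sum>i<num_fac I. charge I i * y_til I Z \<Gamma> x i)
     + (\<Sum>i<num_fac I. \<Sum>j<num_cl I. asg I i j * x i j / \<Gamma>)"

definition partial_potential :: "ccfl \<Rightarrow> real \<Rightarrow> real \<Rightarrow> assignment \<Rightarrow> nat \<Rightarrow> nat \<Rightarrow> real" where
  "partial_potential I Z \<Gamma> x i j =
     deriv (\<lambda>t. potential I Z \<Gamma> (x(i := (x i)(j := t)))) (x i j)"

definition rate :: "ccfl \<Rightarrow> real \<Rightarrow> real \<Rightarrow> assignment \<Rightarrow> nat \<Rightarrow> nat \<Rightarrow> real" where
  "rate I Z \<Gamma> x i j =
     Z * partial_potential I Z \<Gamma> x i j
     + charge I i / \<Gamma> * (demand I i j / Z + of_bool (x i j = \<Gamma> * w_til I \<Gamma> x i))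
     + asg I i j / \<Gamma>"

definition eps :: "ccfl \<Rightarrow> real \<Rightarrow> real \<Rightarrow> assignment \<Rightarrow> nat \<Rightarrow> real" where
  "eps I Z \<Gamma> x j = (mu I - 1) * (MIN i\<in>{..<num_fac I}. rate I Z \<Gamma> x i j)"

definition x_init :: "ccfl \<Rightarrow> nat \<Rightarrow> nat \<Rightarrow> real" where
  "x_init I i j =
     1 / (2 * real (num_fac I) * real (num_cl I))
     * ((MIN i'\<in>{..<num_fac I}. total I i' j) / total I i j)"


subsection \<open>Algorithm Assign and the doubling procedure\<close>

definition arrive :: "ccfl \<Rightarrow> real \<Rightarrow> nat \<Rightarrow> assignment \<Rightarrow> assignment" where
  "arrive I Z j x = (\<lambda>i k. if k = j \<and> i \<in> near I Z j then x_init I i j else x i k)"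

definition raise_step :: "ccfl \<Rightarrow> real \<Rightarrow> real \<Rightarrow> nat \<Rightarrow> assignment \<Rightarrow> assignment" where
  "raise_step I Z \<Gamma> j x = (\<lambda>i k.
     if k = j \<and> i \<in> near I Z j then
       (let up = x i j * (1 + eps I Z \<Gamma> x j / rate I Z \<Gamma> x i j) in
        if w_til I \<Gamma> x i > x i j / \<Gamma> then min (\<Gamma> * w_til I \<Gamma> x i) up else up)
     else x i k)"

text \<open>The processing of one client. The flag records whether FAIL was returned, which is tested
  after each round of the while loop. The value \<open>None\<close> stands for a loop that does not terminate.\<close>

definition serve ::
    "ccfl \<Rightarrow> real \<Rightarrow> real \<Rightarrow> nat \<Rightarrow> assignment \<Rightarrow> (assignment \<times> bool) option" where
  "serve I Z \<Gamma> j x = while_option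
     (\<lambda>(x, failed). \<not> failed \<and> (\<Sum>i<num_fac I. x i j) < 1)
     (\<lambda>(x, failed). let x' = raise_step I Z \<Gamma> j x
                     in (x', alg_cost I Z \<Gamma> x' > 5 * Z * log_emn I))
     (arrive I Z j x, False)"

text \<open>The result of Assign on a list of clients consists of the variables it reaches and the
  clients left unassigned, which start with the client at which it failed. There are none
  precisely if it does not fail.\<close>

fun assign_clients ::
    "ccfl \<Rightarrow> real \<Rightarrow> real \<Rightarrow> nat list \<Rightarrow> assignment \<Rightarrow> (assignment \<times> nat list) option" where
  "assign_clients I Z \<Gamma> [] x = Some (x, [])"
| "assign_clients I Z \<Gamma> (j # js) x =
     do {
       (x', failed) \<leftarrow> serve I Z \<Gamma> j x;
       if failed then Some (x', j # js) else assign_clients I Z \<Gamma> js x'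
     }"

text \<open>The list of all trials, each given by its parameter \<open>\<Gamma>\<close> and the variables it reaches;
  \<open>None\<close> if the procedure does not terminate.\<close>

partial_function (option) trials_from ::
    "ccfl \<Rightarrow> real \<Rightarrow> real \<Rightarrow> nat list \<Rightarrow> (real \<times> assignment) list option" where
  "trials_from I Z \<Gamma> js =
     do {
       (x, js') \<leftarrow> assign_clients I Z \<Gamma> js (\<lambda>i j. 0);
       if js' = [] then Some [(\<Gamma>, x)]
       else do {
         ts \<leftarrow> trials_from I Z (2 * \<Gamma>) js';
         Some ((\<Gamma>, x) # ts)
       }
     }"

definition doubling :: "ccfl \<Rightarrow> real \<Rightarrow> (real \<times> assignment) list option" where
  "doubling I Z = trials_from I Z 1 [0..<num_cl I]"

definition trial_cost :: "ccfl \<Rightarrow> real \<Rightarrow> real \<times> assignment \<Rightarrow> real" where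
  "trial_cost I Z = (\<lambda>(\<Gamma>, x).
     \<Gamma> * ((\<Sum>i<num_fac I. charge I i * y_til I Z \<Gamma> x i) + Z * l_til I Z \<Gamma> x
          + (\<Sum>i<num_fac I. \<Sum>j<num_cl I. asg I i j * x i j / \<Gamma>)))"

definition cumulative_cost :: "ccfl \<Rightarrow> real \<Rightarrow> (real \<times> assignment) list \<Rightarrow> real" where
  "cumulative_cost I Z ts = (\<Sum>t\<leftarrow>ts. trial_cost I Z t)"

text \<open>The fractional solution obtained: the variables of the trials, with \<open>y_til\<close> and \<open>l_til\<close>
  scaled back by \<open>\<Gamma>\<close>, are added up, so that the objective value is the cumulative cost. The
  constraint \<open>\<lambda> \<ge> 1\<close> is not ensured by the algorithm itself, and \<open>sol_l\<close> enforces it; this adds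
  at most \<open>Z\<close>, which is a lower bound on \<open>opt1\<close>.\<close>

definition sol_x :: "(real \<times> assignment) list \<Rightarrow> assignment" where
  "sol_x ts i j = (\<Sum>(\<Gamma>, x)\<leftarrow>ts. x i j)"

definition sol_y :: "ccfl \<Rightarrow> real \<Rightarrow> (real \<times> assignment) list \<Rightarrow> nat \<Rightarrow> real" where
  "sol_y I Z ts i = (\<Sum>(\<Gamma>, x)\<leftarrow>ts. \<Gamma> * y_til I Z \<Gamma> x i)"

definition sol_l :: "ccfl \<Rightarrow> real \<Rightarrow> (real \<times> assignment) list \<Rightarrow> real" where
  "sol_l I Z ts = max 1 (\<Sum>(\<Gamma>, x)\<leftarrow>ts. \<Gamma> * l_til I Z \<Gamma> x)"

end

theory Submission
  imports Defs
begin

text \<open>Fix a feasible LP solution. In a trial, every round with step parameter \<open>\<epsilon>\<close> raises the cost by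
  \<open>O(\<epsilon>)\<close>, so it suffices to bound the sum \<open>E\<close> of these parameters. Weighting
  \<open>\<epsilon> = r i j * (\<epsilon> / r i j)\<close> with the LP solution, the sum of the growth terms
  \<open>\<epsilon> / r i j\<close> for a fixed pair is \<open>O(ln (m n \<rho>))\<close>, since each of them multiplies \<open>x i j\<close> by
  about \<open>1 + \<epsilon> / r i j\<close>. The rates \<open>r i j\<close> contain the shares of \<open>i\<close> and \<open>(i, j)\<close> in the two
  exponential sums of the potential. The maxima of these shares over the whole trial add up to
  only \<open>1 + \<close> the logarithm of the exponential sum, hence to \<open>O(ln (m n))\<close> as long as the cost
  is not beyond the failure threshold. The indicator part of \<open>r i j\<close> is active only
  while \<open>x i j\<close> is the maximum of its row, and is paid for by the growth of this maximum. Thus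
  \<open>E = O(ln (m n) ln (m n \<rho>)) OPT / \<Gamma>\<close>. A failing trial has \<open>E = \<Omega>(Z ln (m n))\<close>, so
  \<open>\<Gamma> = O(ln (m n \<rho>)) OPT / Z\<close>, while every trial costs \<open>O(\<Gamma> Z ln (m n))\<close>; the parameters \<open>\<Gamma>\<close>
  double, so the last trial dominates.\<close>

section \<open>Log-sum-exp\<close>

text \<open>Raising every exponent by at most \<open>D\<close> multiplies the sum by at most
  \<open>exp D\<close>. This crude bound suffices for arrivals, where all increments are
  tiny.\<close>

lemma ln_sum_exp_shift_le:
  fixes f d :: "'a \<Rightarrow> real"
  assumes K: "finite K" "K \<noteq> {}" and d: "\<And>k. k \<in> K \<Longrightarrow> d k \<le> D"
  shows "ln (\<Sum>k\<in>K. exp (f k + d k)) \<le> ln (\<Sum>k\<in>K. exp (f k)) + D"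
proof -
  have pos: "0 < (\<Sum>k\<in>K. exp (f k))" "0 < (\<Sum>k\<in>K. exp (f k + d k))"
    using K by (auto intro: sum_pos)
  have "(\<Sum>k\<in>K. exp (f k + d k)) \<le> (\<Sum>k\<in>K. exp D * exp (f k))"
    by (intro sum_mono) (use d in \<open>auto simp flip: exp_add\<close>)
  also have "\<dots> = exp D * (\<Sum>k\<in>K. exp (f k))"
    by (simp add: sum_distrib_left)
  finally have "ln (\<Sum>k\<in>K. exp (f k + d k)) \<le> ln (exp D * (\<Sum>k\<in>K. exp (f k)))"
    using pos by simp
  also have "\<dots> = ln (\<Sum>k\<in>K. exp (f k)) + D"
    using pos by (simp add: ln_mult)
  finally show ?thesis .
qed

text \<open>From \<open>1 - d \<le> exp (- d)\<close> follows
  \<open>exp d - 1 \<le> d * exp d\<close>, and \<open>exp 2 \<le> 9\<close>. This 9 is the factor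
  in front of \<open>eps\<close> wherever the cost is tracked.\<close>

lemma exp_minus_one_le:
  fixes d :: real
  assumes "0 \<le> d" "d \<le> 2"
  shows "exp d - 1 \<le> 9 * d"
proof -
  have "exp d \<le> exp (1 + 1)"
    using assms by simp
  also have "\<dots> = exp 1 * exp (1::real)"
    by (rule exp_add)
  also have "\<dots> \<le> 3 * 3"
    by (intro mult_mono) (use exp_le in auto)
  finally have "exp d \<le> 9"
    by simp
  moreover have "1 - d \<le> exp (- d)"
    using exp_ge_add_one_self[of "-d"] by simp
  hence "exp d * (1 - d) \<le> exp d * exp (- d)"
    by (intro mult_left_mono) auto
  hence "exp d - 1 \<le> exp d * d"
    by (simp add: exp_minus algebra_simps)
  moreover have "exp d * d \<le> 9 * d" if "exp d \<le> 9"
    using that assms by (intro mult_right_mono)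
  ultimately show ?thesis
    by linarith
qed

text \<open>The last sum is the first-order change of log-sum-exp, whose gradient consists of the
  shares. For increments between 0 and 2 the true change is at most 9 times as large.\<close>

lemma ln_sum_exp_increase_le:
  fixes f d :: "'a \<Rightarrow> real"
  assumes K: "finite K" "K \<noteq> {}" and d: "\<And>k. k \<in> K \<Longrightarrow> 0 \<le> d k" "\<And>k. k \<in> K \<Longrightarrow> d k \<le> 2"
  shows "ln (\<Sum>k\<in>K. exp (f k + d k))
    \<le> ln (\<Sum>k\<in>K. exp (f k)) + 9 * (\<Sum>k\<in>K. exp (f k) / (\<Sum>k\<in>K. exp (f k)) * d k)"
proof -
  define S where "S = (\<Sum>k\<in>K. exp (f k))"
  have S: "0 < S" "0 < (\<Sum>k\<in>K. exp (f k + d k))"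
    using K by (auto intro: sum_pos simp: S_def)
  have "(\<Sum>k\<in>K. exp (f k + d k)) \<le> (\<Sum>k\<in>K. exp (f k) * (1 + 9 * d k))"
    unfolding exp_add using d exp_minus_one_le by (intro sum_mono mult_left_mono) fastforce+
  also have "\<dots> = S + 9 * (\<Sum>k\<in>K. exp (f k) * d k)"
    by (simp add: S_def algebra_simps sum.distrib sum_distrib_left)
  also have "\<dots> = S * (1 + 9 * (\<Sum>k\<in>K. exp (f k) / S * d k))"
    using S by (simp add: algebra_simps sum_distrib_left)
  finally have le: "(\<Sum>k\<in>K. exp (f k + d k)) \<le> S * (1 + 9 * (\<Sum>k\<in>K. exp (f k) / S * d k))" .
  have nn: "0 \<le> (\<Sum>k\<in>K. exp (f k) / S * d k)"
    using S d by (intro sum_nonneg) auto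
  have "ln (\<Sum>k\<in>K. exp (f k + d k)) \<le> ln (S * (1 + 9 * (\<Sum>k\<in>K. exp (f k) / S * d k)))"
    using le S by simp
  also have "\<dots> = ln S + ln (1 + 9 * (\<Sum>k\<in>K. exp (f k) / S * d k))"
    using S nn by (simp add: ln_mult)
  also have "\<dots> \<le> ln S + 9 * (\<Sum>k\<in>K. exp (f k) / S * d k)"
    using ln_add_one_self_le_self[of "9 * (\<Sum>k\<in>K. exp (f k) / S * d k)"] nn by simp
  finally show ?thesis
    by (simp add: S_def)
qed

text \<open>Makes increments measured relative to the new value telescope; it is
  \<open>ln y \<le> y - 1\<close> at \<open>y = s / t\<close>.\<close>

lemma one_minus_inverse_le_ln:
  fixes s t :: real
  assumes "0 < s" "0 < t"
  shows "(t - s) / t \<le> ln t - ln s"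
  using ln_le_minus_one[of "s / t"] assms by (simp add: ln_div diff_divide_distrib)

text \<open>The shares add up to 1, which is the constant term; the logarithm pays for the later
  growth of \<open>M\<close>. At the start \<open>M\<close> can be the shares themselves if the
  logarithm is nonnegative.\<close>

definition share_bound :: "'a set \<Rightarrow> ('a \<Rightarrow> real) \<Rightarrow> ('a \<Rightarrow> real) \<Rightarrow> bool" where
  "share_bound K u M \<longleftrightarrow> (\<forall>k\<in>K. u k / sum u K \<le> M k) \<and> sum M K \<le> 1 + ln (sum u K)"

text \<open>Although the shares \<open>u k / sum u K\<close> are not monotone as the weights grow, a monotone upper
  bound \<open>M\<close> on them needs to grow by at most \<open>(u' k - u k) / sum u' K\<close>, and these increments
  telescope logarithmically.\<close>

lemma share_bound_update:
  fixes u u' M :: "'a \<Rightarrow> real"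
  assumes sb: "share_bound K u M" and K: "finite K" "K \<noteq> {}"
    and pos: "\<And>k. k \<in> K \<Longrightarrow> 0 < u k" and le: "\<And>k. k \<in> K \<Longrightarrow> u k \<le> u' k"
  obtains M' where "share_bound K u' M'" "\<And>k. k \<in> K \<Longrightarrow> M k \<le> M' k"
proof
  define M' where "M' = (\<lambda>k. M k + (u' k - u k) / sum u' K)"
  have S: "0 < sum u K" using K pos by (auto intro: sum_pos)
  have SS: "sum u K \<le> sum u' K" using le by (intro sum_mono)
  show "M k \<le> M' k" if "k \<in> K" for k
    using le[OF that] S SS by (simp add: M'_def)
  have "u' k / sum u' K \<le> M' k" if "k \<in> K" for k
  proof -
    have "u k / sum u' K \<le> u k / sum u K"
      using pos[OF that] S SS by (intro divide_left_mono mult_pos_pos) auto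
    also have "\<dots> \<le> M k" using sb that by (simp add: share_bound_def)
    finally show ?thesis by (simp add: M'_def diff_divide_distrib)
  qed
  moreover have "sum M' K \<le> 1 + ln (sum u' K)"
  proof -
    have "sum M' K = sum M K + (sum u' K - sum u K) / sum u' K"
      by (simp add: M'_def sum.distrib sum_subtractf flip: sum_divide_distrib)
    also have "\<dots> \<le> 1 + ln (sum u K) + (ln (sum u' K) - ln (sum u K))"
      using sb one_minus_inverse_le_ln[of "sum u K" "sum u' K"] S SS
      by (intro add_mono) (auto simp: share_bound_def)
    finally show ?thesis by simp
  qed
  ultimately show "share_bound K u' M'" by (simp add: share_bound_def)
qed

section \<open>A single trial\<close>

text \<open>\<open>xs\<close>, \<open>ys\<close>, \<open>ls\<close> form an arbitrary feasible LP
  solution, unknown to the algorithm, with which it is compared. The infimum over all such solutions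
  is taken at the very end.\<close>

locale trial =
  fixes I :: ccfl and Z \<Gamma> :: real and xs :: assignment and ys :: "nat \<Rightarrow> real" and ls :: real
  assumes inst: "ccfl_instance I" and Z_pos: "0 < Z" and Gamma_ge_1: "1 \<le> \<Gamma>"
    and feasible: "lp1_feasible I Z xs ys ls"
begin

abbreviation "m \<equiv> num_fac I"
abbreviation "n \<equiv> num_cl I"
abbreviation "c \<equiv> charge I"
abbreviation "p \<equiv> demand I"
abbreviation "a \<equiv> asg I"
abbreviation "v \<equiv> v_til I Z \<Gamma>"
abbreviation "w \<equiv> w_til I \<Gamma>"
abbreviation "r \<equiv> rate I Z \<Gamma>"
abbreviation "obj \<equiv> lp1_objective I Z xs ys ls"

definition load_weight :: "assignment \<Rightarrow> nat \<Rightarrow> real" where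
  "load_weight x i = exp (v x i)"

text \<open>Indexed by pairs, so that the double sum in the potential becomes a single sum to which
  the log-sum-exp bounds apply.\<close>

definition asg_weight :: "assignment \<Rightarrow> nat \<times> nat \<Rightarrow> real" where
  "asg_weight x = (\<lambda>(i, j). exp (x i j / \<Gamma>))"

abbreviation "U x \<equiv> sum (load_weight x) {..<m}"
abbreviation "Q x \<equiv> sum (asg_weight x) ({..<m} \<times> {..<n})"

text \<open>A common lower bound on all values \<open>x_init\<close>. As entries stay at most 2, an
  entry can grow by a factor of at most \<open>2 / beta\<close> after the arrival of its
  client.\<close>

definition beta :: real where
  "beta = 1 / (2 * real m * real n * rho I)"

section \<open>Sizes, signs and the constraints of the comparison solution\<close>

lemma size_ge_2: "2 \<le> m" "2 \<le> n"
  and charge_nonneg: "i < m \<Longrightarrow> 0 \<le> c i"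
  and demand_nonneg: "i < m \<Longrightarrow> j < n \<Longrightarrow> 0 \<le> p i j"
  and asg_nonneg: "i < m \<Longrightarrow> j < n \<Longrightarrow> 0 \<le> a i j"
  and total_pos: "i < m \<Longrightarrow> j < n \<Longrightarrow> 0 < total I i j"
  using inst by (auto simp: ccfl_instance_def)

lemma index_sets_nonempty: "{..<m} \<noteq> {}" "{..<n} \<noteq> {}"
  using size_ge_2 by (auto simp: lessThan_empty_iff)

lemma Gamma_pos: "0 < \<Gamma>"
  using Gamma_ge_1 by simp

lemma size_prod_ge_4: "4 \<le> real m * real n"
  using mult_mono[of 2 "real m" 2 "real n"] size_ge_2 by simp

lemma near_lt: "i \<in> near I Z j \<Longrightarrow> i < m"
  by (simp add: near_def)

lemma near_le:
  assumes "i \<in> near I Z j" "j < n"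
  shows "c i \<le> Z" "p i j \<le> Z" "a i j \<le> Z"
  using assms charge_nonneg[of i] demand_nonneg[of i j] asg_nonneg[of i j]
  by (auto simp: near_def total_def)

lemma xs_nonneg: "i < m \<Longrightarrow> j < n \<Longrightarrow> 0 \<le> xs i j"
  and ys_nonneg: "i < m \<Longrightarrow> 0 \<le> ys i"
  and xs_le_ys: "i < m \<Longrightarrow> j < n \<Longrightarrow> xs i j \<le> ys i"
  and ys_le_ls: "i < m \<Longrightarrow> ys i \<le> ls"
  and ls_ge_1: "1 \<le> ls"
  and xs_load: "i < m \<Longrightarrow> (\<Sum>j<n. p i j * xs i j) \<le> Z * ys i"
  and xs_sum: "j < n \<Longrightarrow> 1 \<le> (\<Sum>i<m. xs i j)"
  and xs_near: "i < m \<Longrightarrow> j < n \<Longrightarrow> i \<notin> near I Z j \<Longrightarrow> xs i j = 0"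
  using feasible by (auto simp: lp1_feasible_def)

text \<open>Client \<open>j\<close> must be served by the LP solution, which uses near facilities
  only.\<close>

lemma near_nonempty:
  assumes "j < n"
  obtains i where "i \<in> near I Z j"
proof -
  have "\<exists>i<m. xs i j \<noteq> 0"
  proof (rule ccontr)
    assume "\<not> ?thesis"
    hence "(\<Sum>i<m. xs i j) = 0" by simp
    thus False using xs_sum[OF assms] by simp
  qed
  thus ?thesis using that xs_near assms by blast
qed

lemma obj_ge: "Z \<le> obj"
proof -
  have "Z * 1 \<le> Z * ls"
    using Z_pos ls_ge_1 by (intro mult_left_mono) auto
  moreover have "0 \<le> (\<Sum>i<m. c i * ys i)"
    by (intro sum_nonneg) (auto simp: charge_nonneg ys_nonneg)
  moreover have "0 \<le> (\<Sum>i<m. \<Sum>j<n. a i j * xs i j)"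
    by (intro sum_nonneg) (auto simp: asg_nonneg xs_nonneg)
  ultimately show ?thesis by (simp add: lp1_objective_def)
qed

lemma log_emn_eq: "log_emn I = 1 + ln (real m * real n)"
  using size_ge_2 by (simp add: log_emn_def ln_mult)

lemma ln_size_ge_1: "1 \<le> ln (real m * real n)"
proof -
  have "exp 1 \<le> real m * real n" using exp_le size_prod_ge_4 by linarith
  thus ?thesis using size_prod_ge_4 by (subst ln_ge_iff) auto
qed

lemma log_emn_ge_2: "2 \<le> log_emn I"
  using ln_size_ge_1 by (simp add: log_emn_eq)

section \<open>The ratio \<open>rho\<close> and the initial values\<close>

lemma rho_ge:
  assumes "i < m" "j < n"
  shows "total I i j / (MIN i'\<in>{..<m}. total I i' j) \<le> rho I"
proof -
  have "0 < (MIN i'\<in>{..<m}. total I i' j)"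
    using assms by (subst Min_gr_iff) (auto simp: total_pos)
  hence "total I i j / (MIN i'\<in>{..<m}. total I i' j)
      \<le> (MAX i'\<in>{..<m}. total I i' j) / (MIN i'\<in>{..<m}. total I i' j)"
    using assms by (intro divide_right_mono) auto
  also have "\<dots> \<le> rho I"
    unfolding rho_def using assms by (intro Max_ge) auto
  finally show ?thesis .
qed

lemma min_total_pos: "j < n \<Longrightarrow> 0 < (MIN i\<in>{..<m}. total I i j)"
  using index_sets_nonempty by (subst Min_gr_iff) (auto simp: total_pos)

lemma rho_ge_1: "1 \<le> rho I"
proof -
  have "0 < m" "0 < n" using size_ge_2 by auto
  moreover have "(MIN i\<in>{..<m}. total I i 0) \<le> total I 0 0"
    using \<open>0 < m\<close> by (intro Min_le) auto
  ultimately show ?thesis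
    using rho_ge[of 0 0] min_total_pos[of 0] by (smt (verit) le_divide_eq_1_pos)
qed

lemma beta_pos: "0 < beta"
  using size_ge_2 rho_ge_1 by (simp add: beta_def)

lemma beta_le_1: "beta \<le> 1"
proof -
  have "1 * 1 \<le> (2 * real m * real n) * rho I"
    using size_prod_ge_4 rho_ge_1 by (intro mult_mono) auto
  thus ?thesis using frac_le[of 1 1 1 "2 * real m * real n * rho I"] by (simp add: beta_def)
qed

lemma x_init_ge_beta:
  assumes "i < m" "j < n"
  shows "beta \<le> x_init I i j"
proof -
  have *: "0 < total I i j" "0 < (MIN i'\<in>{..<m}. total I i' j)"
    using assms total_pos min_total_pos by auto
  have "1 / rho I \<le> 1 / (total I i j / (MIN i'\<in>{..<m}. total I i' j))"
    using * assms rho_ge rho_ge_1 by (intro divide_left_mono mult_pos_pos divide_pos_pos) auto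
  hence "1 / (2 * real m * real n) * (1 / rho I)
      \<le> 1 / (2 * real m * real n) * ((MIN i'\<in>{..<m}. total I i' j) / total I i j)"
    by (intro mult_left_mono) auto
  thus ?thesis by (simp add: beta_def x_init_def)
qed

text \<open>By the choice of \<open>x_init\<close> the total of \<open>i\<close> cancels and leaves
  the minimum, which is at most \<open>Z\<close> because \<open>i\<close> is near. Summed over the
  facilities, an arrival thus costs only \<open>O(Z / n)\<close>.\<close>

lemma x_init_total_le:
  assumes "i \<in> near I Z j" "j < n"
  shows "total I i j * x_init I i j \<le> Z / (2 * real m * real n)"
proof -
  have "(MIN i'\<in>{..<m}. total I i' j) \<le> total I i j"
    using near_lt[OF assms(1)] by (intro Min_le) auto
  also have "\<dots> \<le> Z" using assms by (simp add: near_def)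
  finally have "(MIN i'\<in>{..<m}. total I i' j) \<le> Z" .
  moreover have "total I i j * x_init I i j = (MIN i'\<in>{..<m}. total I i' j) / (2 * real m * real n)"
    using total_pos[OF near_lt[OF assms(1)] assms(2)] by (simp add: x_init_def)
  ultimately show ?thesis by (simp add: divide_right_mono)
qed

lemma x_init_le:
  assumes "i < m" "j < n"
  shows "x_init I i j \<le> 1 / (2 * real m * real n)"
proof -
  have "(MIN i'\<in>{..<m}. total I i' j) \<le> total I i j"
    using assms by (intro Min_le) auto
  hence "(MIN i'\<in>{..<m}. total I i' j) / total I i j \<le> 1"
    using total_pos assms by simp
  hence "1 / (2 * real m * real n) * ((MIN i'\<in>{..<m}. total I i' j) / total I i j)
      \<le> 1 / (2 * real m * real n) * 1"
    by (intro mult_left_mono) auto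
  thus ?thesis by (simp add: x_init_def)
qed

section \<open>Row maxima\<close>

lemma Gamma_w: "\<Gamma> * w x i = (MAX j\<in>{..<n}. x i j)"
  using Gamma_pos by (simp add: w_til_def)

lemma le_Gamma_w: "j < n \<Longrightarrow> x i j \<le> \<Gamma> * w x i"
  unfolding Gamma_w by (intro Max_ge) auto

lemma Gamma_w_le: "(\<And>j. j < n \<Longrightarrow> x i j \<le> b) \<Longrightarrow> \<Gamma> * w x i \<le> b"
  unfolding Gamma_w using index_sets_nonempty by (subst Max_le_iff) auto

section \<open>Partial derivatives of the potential and the rates\<close>

lemma potential_eq: "potential I Z \<Gamma> x = ln (U x) + ln (Q x)"
  by (simp add: potential_def load_weight_def asg_weight_def v_til_def sum.cartesian_product
      case_prod_unfold)

lemma load_weight_pos: "0 < load_weight x i" and asg_weight_pos: "0 < asg_weight x ij"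
  by (auto simp: load_weight_def asg_weight_def split: prod.splits)

lemma weights_pos: "0 < U x" "0 < Q x"
  using index_sets_nonempty by (auto intro!: sum_pos load_weight_pos asg_weight_pos)

text \<open>Only the load of row \<open>i\<close> and the weight of the pair \<open>(i, j)\<close>
  depend on \<open>x i j\<close>. By the chain rule each logarithm contributes the corresponding
  share, times the derivative of the exponent.\<close>

lemma partial_potential_eq:
  assumes "i < m" "j < n"
  shows "partial_potential I Z \<Gamma> x i j
    = p i j / (Z * \<Gamma>) * (load_weight x i / U x) + asg_weight x (i, j) / Q x / \<Gamma>"
proof -
  define X where "X = (\<lambda>t. x(i := (x i)(j := t)))"
  have X0: "X (x i j) = x" by (simp add: X_def)
  have dv: "((\<lambda>t. load_weight (X t) i') has_real_derivative
      (if i' = i then load_weight x i * (p i j / (Z * \<Gamma>)) else 0)) (at (x i j))" for i'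
  proof (cases "i' = i")
    case True
    have "((\<lambda>t. \<Sum>k<n. p i k * X t i k) has_real_derivative (\<Sum>k<n. if k = j then p i j else 0)) (at (x i j))"
      by (intro DERIV_sum) (auto simp: X_def intro!: derivative_eq_intros)
    hence "((\<lambda>t. \<Sum>k<n. p i k * X t i k) has_real_derivative p i j) (at (x i j))"
      using assms by (simp add: sum.delta)
    hence "((\<lambda>t. (\<Sum>k<n. p i k * X t i k) / (Z * \<Gamma>)) has_real_derivative p i j / (Z * \<Gamma>)) (at (x i j))"
      by (rule DERIV_cdivide)
    from DERIV_fun_exp[OF this] show ?thesis
      using True by (simp add: load_weight_def v_til_def X0)
  qed (simp add: load_weight_def v_til_def X_def)
  have "((\<lambda>t. U (X t)) has_real_derivative
      (\<Sum>i'<m. if i' = i then load_weight x i * (p i j / (Z * \<Gamma>)) else 0)) (at (x i j))"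
    by (intro DERIV_sum dv)
  hence dU: "((\<lambda>t. U (X t)) has_real_derivative load_weight x i * (p i j / (Z * \<Gamma>))) (at (x i j))"
    using assms by (simp add: sum.delta)
  have dq: "((\<lambda>t. asg_weight (X t) ij) has_real_derivative
      (if ij = (i, j) then asg_weight x (i, j) * (1 / \<Gamma>) else 0)) (at (x i j))" for ij
  proof (cases "ij = (i, j)")
    case True
    have "((\<lambda>t. exp (t / \<Gamma>)) has_real_derivative exp (x i j / \<Gamma>) * (1 / \<Gamma>)) (at (x i j))"
      by (intro derivative_eq_intros) (use Gamma_pos in auto)
    thus ?thesis using True by (simp add: asg_weight_def X_def)
  next
    case False
    hence "asg_weight (X t) ij = asg_weight x ij" for t
      by (auto simp: asg_weight_def X_def split: prod.splits)
    thus ?thesis using False by simp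
  qed
  have "((\<lambda>t. Q (X t)) has_real_derivative
      (\<Sum>ij\<in>{..<m}\<times>{..<n}. if ij = (i, j) then asg_weight x (i, j) * (1 / \<Gamma>) else 0)) (at (x i j))"
    by (intro DERIV_sum dq)
  hence dQ: "((\<lambda>t. Q (X t)) has_real_derivative asg_weight x (i, j) * (1 / \<Gamma>)) (at (x i j))"
    using assms by (simp add: sum.delta)
  have "((\<lambda>t. ln (U (X t))) has_real_derivative
      1 / U x * (load_weight x i * (p i j / (Z * \<Gamma>)))) (at (x i j))"
    using DERIV_chain2[OF DERIV_ln_divide[OF weights_pos(1)] dU] by (simp add: X0)
  moreover have "((\<lambda>t. ln (Q (X t))) has_real_derivative
      1 / Q x * (asg_weight x (i, j) * (1 / \<Gamma>))) (at (x i j))"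
    using DERIV_chain2[OF DERIV_ln_divide[OF weights_pos(2)] dQ] by (simp add: X0)
  ultimately have "((\<lambda>t. potential I Z \<Gamma> (X t)) has_real_derivative
      1 / U x * (load_weight x i * (p i j / (Z * \<Gamma>))) + 1 / Q x * (asg_weight x (i, j) * (1 / \<Gamma>)))
      (at (x i j))"
    unfolding potential_eq by (rule DERIV_add)
  from DERIV_imp_deriv[OF this] show ?thesis
    by (simp add: partial_potential_def X_def mult.commute)
qed

text \<open>The rate without its indicator part. \<open>M\<close> and \<open>N\<close> stand for the
  shares or for upper bounds on them; the certificate uses bounds that hold over the whole
  trial.\<close>

definition smooth_rate :: "(nat \<Rightarrow> real) \<Rightarrow> (nat \<times> nat \<Rightarrow> real) \<Rightarrow> nat \<Rightarrow> nat \<Rightarrow> real" where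
  "smooth_rate M N i j = (p i j * M i + Z * N (i, j) + c i * p i j / Z + a i j) / \<Gamma>"

lemma rate_eq:
  assumes "i < m" "j < n"
  shows "r x i j = smooth_rate (\<lambda>i. load_weight x i / U x) (\<lambda>ij. asg_weight x ij / Q x) i j
    + c i / \<Gamma> * of_bool (x i j = \<Gamma> * w x i)"
  unfolding rate_def partial_potential_eq[OF assms] smooth_rate_def
  using Z_pos Gamma_pos by (simp add: field_simps)

lemma smooth_rate_mono:
  assumes "i < m" "j < n" "M i \<le> M' i" "N (i, j) \<le> N' (i, j)"
  shows "smooth_rate M N i j \<le> smooth_rate M' N' i j"
  unfolding smooth_rate_def using assms Z_pos Gamma_pos demand_nonneg[of i j]
  by (intro divide_right_mono add_mono mult_left_mono order_refl) auto

lemma shares_le_1: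
  assumes "i < m" "j < n"
  shows "load_weight x i / U x \<le> 1" "asg_weight x (i, j) / Q x \<le> 1"
proof -
  have "load_weight x i \<le> U x" "asg_weight x (i, j) \<le> Q x"
    using assms by (auto intro!: member_le_sum less_imp_le[OF load_weight_pos] less_imp_le[OF asg_weight_pos])
  thus "load_weight x i / U x \<le> 1" "asg_weight x (i, j) / Q x \<le> 1"
    using weights_pos by simp_all
qed

text \<open>Of the nonnegative parts of the rate only the share of the pair is kept. It never
  vanishes, so rates are positive and quotients by them meaningful.\<close>

lemma rate_ge:
  assumes "i < m" "j < n"
  shows "Z * (asg_weight x (i, j) / Q x) / \<Gamma> \<le> r x i j"
proof -
  have "smooth_rate (\<lambda>_. 0) (\<lambda>ij. asg_weight x ij / Q x) i j \<le> r x i j - c i / \<Gamma> * of_bool (x i j = \<Gamma> * w x i)"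
    unfolding rate_eq[OF assms]
    using smooth_rate_mono[OF assms, of "\<lambda>_. 0"] weights_pos[of x] load_weight_pos[of x i] by simp
  moreover have "Z * (asg_weight x (i, j) / Q x) / \<Gamma> \<le> smooth_rate (\<lambda>_. 0) (\<lambda>ij. asg_weight x ij / Q x) i j"
    unfolding smooth_rate_def
    using assms Gamma_pos Z_pos charge_nonneg demand_nonneg asg_nonneg by (intro divide_right_mono) auto
  moreover have "0 \<le> c i / \<Gamma> * of_bool (x i j = \<Gamma> * w x i)"
    using assms Gamma_pos charge_nonneg by simp
  ultimately show ?thesis by linarith
qed

lemma rate_pos:
  assumes "i < m" "j < n"
  shows "0 < r x i j"
proof -
  have "0 < Z * (asg_weight x (i, j) / Q x) / \<Gamma>"
    using Z_pos Gamma_pos weights_pos[of x] asg_weight_pos by simp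
  thus ?thesis using rate_ge[OF assms] by (rule less_le_trans)
qed

text \<open>Each of the five parts of the rate is at most \<open>Z\<close>, since shares are at most
  1 and charge, demand and assignment cost of a near facility are at most \<open>Z\<close>.\<close>

lemma rate_le:
  assumes "i \<in> near I Z j" "j < n"
  shows "r x i j \<le> 5 * Z"
proof -
  have i: "i < m" using assms near_lt by simp
  have g: "y / \<Gamma> \<le> y" if "0 \<le> y" for y
    using that Gamma_ge_1 mult_right_mono[of 1 \<Gamma> y] by (simp add: field_simps)
  have cp: "c i * p i j / Z \<le> Z"
    using near_le[OF assms] charge_nonneg[OF i] demand_nonneg[OF i assms(2)] Z_pos
    by (simp add: pos_divide_le_eq mult_mono)
  have "smooth_rate (\<lambda>i. load_weight x i / U x) (\<lambda>ij. asg_weight x ij / Q x) i j \<le> smooth_rate (\<lambda>_. 1) (\<lambda>_. 1) i j"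
    using shares_le_1[OF i assms(2)] by (intro smooth_rate_mono i assms) auto
  also have "\<dots> \<le> p i j * 1 + Z * 1 + c i * p i j / Z + a i j"
    unfolding smooth_rate_def using i assms Z_pos charge_nonneg demand_nonneg asg_nonneg by (intro g) auto
  also have "\<dots> \<le> 4 * Z"
    using near_le[OF assms] cp by simp
  finally have *: "smooth_rate (\<lambda>i. load_weight x i / U x) (\<lambda>ij. asg_weight x ij / Q x) i j \<le> 4 * Z" .
  have "c i / \<Gamma> * of_bool (x i j = \<Gamma> * w x i) \<le> c i"
    using g charge_nonneg[OF i] by simp
  with * show ?thesis unfolding rate_eq[OF i assms(2)]
    using near_le[OF assms] by linarith
qed

lemma mu_bounds: "0 < mu I - 1" "mu I - 1 \<le> 1 / 12"
  using log_emn_ge_2 by (auto simp: mu_def field_simps)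

lemma eps_le:
  assumes "i < m"
  shows "eps I Z \<Gamma> x j \<le> (mu I - 1) * r x i j"
  unfolding eps_def using mu_bounds assms by (intro mult_left_mono Min_le) auto

lemma eps_ge:
  assumes "\<And>i. i < m \<Longrightarrow> b \<le> r x i j"
  shows "(mu I - 1) * b \<le> eps I Z \<Gamma> x j"
  unfolding eps_def using mu_bounds assms index_sets_nonempty
  by (intro mult_left_mono) auto

lemma eps_pos:
  assumes "j < n"
  shows "0 < eps I Z \<Gamma> x j"
  unfolding eps_def using mu_bounds rate_pos assms index_sets_nonempty
  by (intro mult_pos_pos) auto

text \<open>The relative increase of an uncapped entry in one round. Multiplied by the rate it gives
  \<open>eps\<close>, whatever the facility.\<close>

definition growth :: "assignment \<Rightarrow> nat \<Rightarrow> nat \<Rightarrow> real" where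
  "growth x i j = eps I Z \<Gamma> x j / r x i j"

lemma growth_bounds:
  assumes "i < m" "j < n"
  shows "0 < growth x i j" "growth x i j \<le> mu I - 1" "growth x i j * r x i j = eps I Z \<Gamma> x j"
  using eps_pos[OF assms(2), of x] rate_pos[OF assms, of x] eps_le[OF assms(1), of x j]
  by (auto simp: growth_def divide_le_eq)

section \<open>Changing the column of one client\<close>

definition bump :: "nat \<Rightarrow> (nat \<Rightarrow> real) \<Rightarrow> assignment \<Rightarrow> assignment" where
  "bump j \<delta> x = (\<lambda>i k. if k = j then x i k + \<delta> i else x i k)"

lemma sum_bump:
  assumes "j < n"
  shows "(\<Sum>k<n. f k * bump j \<delta> x i k) = (\<Sum>k<n. f k * x i k) + f j * \<delta> i"
proof -
  have "(\<Sum>k<n. f k * bump j \<delta> x i k) = (\<Sum>k<n. f k * x i k + (if k = j then f j * \<delta> i else 0))"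
    by (intro sum.cong) (auto simp: bump_def algebra_simps)
  thus ?thesis using assms by (simp add: sum.distrib)
qed

lemma v_bump: "j < n \<Longrightarrow> v (bump j \<delta> x) i = v x i + p i j * \<delta> i / (Z * \<Gamma>)"
  by (simp add: v_til_def sum_bump add_divide_distrib)

text \<open>The bounds \<open>dU\<close>, \<open>dQ\<close> on the logarithms and
  \<open>\<omega>\<close> on the row maxima remain parameters, since arrivals and rounds are both
  column changes but need different estimates.\<close>

lemma alg_cost_bump:
  assumes j: "j < n"
    and U: "ln (U (bump j \<delta> x)) \<le> ln (U x) + dU" and Q: "ln (Q (bump j \<delta> x)) \<le> ln (Q x) + dQ"
    and w: "\<And>i. i < m \<Longrightarrow> \<Gamma> * w (bump j \<delta> x) i \<le> \<Gamma> * w x i + \<omega> i"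
  shows "alg_cost I Z \<Gamma> (bump j \<delta> x) \<le> alg_cost I Z \<Gamma> x + Z * (dU + dQ)
    + (\<Sum>i<m. (c i * p i j * \<delta> i / Z + c i * \<omega> i + a i j * \<delta> i) / \<Gamma>)"
proof -
  have "Z * potential I Z \<Gamma> (bump j \<delta> x) \<le> Z * (potential I Z \<Gamma> x + (dU + dQ))"
    unfolding potential_eq using U Q Z_pos by (intro mult_left_mono) auto
  moreover have "(\<Sum>i<m. c i * y_til I Z \<Gamma> (bump j \<delta> x) i)
      \<le> (\<Sum>i<m. c i * y_til I Z \<Gamma> x i) + (\<Sum>i<m. (c i * p i j * \<delta> i / Z + c i * \<omega> i) / \<Gamma>)"
    unfolding sum.distrib[symmetric]
  proof (intro sum_mono)
    fix i assume "i \<in> {..<m}"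
    hence i: "i < m" by simp
    have "w (bump j \<delta> x) i \<le> w x i + \<omega> i / \<Gamma>"
      using w[OF i] Gamma_pos by (simp add: field_simps)
    then have "c i * y_til I Z \<Gamma> (bump j \<delta> x) i
        \<le> c i * (v x i + p i j * \<delta> i / (Z * \<Gamma>) + (w x i + \<omega> i / \<Gamma>))"
      unfolding y_til_def v_bump[OF j] by (intro mult_left_mono charge_nonneg i) auto
    also have "\<dots> = c i * y_til I Z \<Gamma> x i + (c i * p i j * \<delta> i / Z + c i * \<omega> i) / \<Gamma>"
      by (simp add: y_til_def algebra_simps add_divide_distrib)
    finally show "c i * y_til I Z \<Gamma> (bump j \<delta> x) i
        \<le> c i * y_til I Z \<Gamma> x i + (c i * p i j * \<delta> i / Z + c i * \<omega> i) / \<Gamma>" .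
  qed
  moreover have "(\<Sum>i<m. \<Sum>k<n. a i k * bump j \<delta> x i k / \<Gamma>)
      = (\<Sum>i<m. \<Sum>k<n. a i k * x i k / \<Gamma>) + (\<Sum>i<m. a i j * \<delta> i / \<Gamma>)"
    by (simp add: sum_bump[OF j] sum.distrib add_divide_distrib flip: sum_divide_distrib)
  ultimately show ?thesis
    by (simp add: alg_cost_def add_divide_distrib sum.distrib algebra_simps)
qed

lemma bump_weights:
  assumes "j < n" "\<And>i. i < m \<Longrightarrow> 0 \<le> \<delta> i"
  shows "i < m \<Longrightarrow> load_weight x i \<le> load_weight (bump j \<delta> x) i"
    and "ij \<in> {..<m} \<times> {..<n} \<Longrightarrow> asg_weight x ij \<le> asg_weight (bump j \<delta> x) ij"
proof -
  assume "i < m"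
  hence "0 \<le> p i j * \<delta> i / (Z * \<Gamma>)"
    using assms demand_nonneg Z_pos Gamma_pos by (intro divide_nonneg_pos mult_nonneg_nonneg) auto
  thus "load_weight x i \<le> load_weight (bump j \<delta> x) i"
    by (simp add: load_weight_def v_bump[OF assms(1)])
qed (use assms Gamma_pos in \<open>auto simp: asg_weight_def bump_def divide_right_mono\<close>)

lemma w_bump_mono:
  assumes "\<And>i. i < m \<Longrightarrow> 0 \<le> \<delta> i" "i < m"
  shows "\<Gamma> * w x i \<le> \<Gamma> * w (bump j \<delta> x) i"
proof (intro Gamma_w_le)
  fix k assume "k < n"
  have "x i k \<le> bump j \<delta> x i k" using assms by (simp add: bump_def)
  also have "\<dots> \<le> \<Gamma> * w (bump j \<delta> x) i" by (intro le_Gamma_w \<open>k < n\<close>)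
  finally show "x i k \<le> \<Gamma> * w (bump j \<delta> x) i" .
qed

lemma w_bump_le:
  assumes "\<Gamma> * w x i \<le> b" "x i j + \<delta> i \<le> b"
  shows "\<Gamma> * w (bump j \<delta> x) i \<le> b"
proof (intro Gamma_w_le)
  fix k assume "k < n"
  thus "bump j \<delta> x i k \<le> b" using le_Gamma_w[of k x i] assms by (auto simp: bump_def)
qed

subsection \<open>States and the fractional certificate\<close>

text \<open>The bound 2 holds because an entry is below 1 before a round and a round at most doubles
  it.\<close>

definition state :: "assignment \<Rightarrow> bool" where
  "state x \<longleftrightarrow> (\<forall>i<m. \<forall>j<n. (x i j = 0 \<or> beta \<le> x i j) \<and> x i j \<le> 2 \<and> (i \<notin> near I Z j \<longrightarrow> x i j = 0))"

lemma state_nonneg: "state x \<Longrightarrow> i < m \<Longrightarrow> j < n \<Longrightarrow> 0 \<le> x i j"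
  using beta_pos by (force simp: state_def)

lemma w_nonneg: "state x \<Longrightarrow> i < m \<Longrightarrow> 0 \<le> w x i"
  using state_nonneg[of x i 0] le_Gamma_w[of 0 x i] size_ge_2 Gamma_pos
  by (smt (verit) zero_less_mult_iff gr0I not_numeral_le_zero mult_neg_pos mult_pos_neg)

lemma v_nonneg: "state x \<Longrightarrow> i < m \<Longrightarrow> 0 \<le> v x i"
  unfolding v_til_def using Z_pos Gamma_pos demand_nonneg state_nonneg
  by (intro divide_nonneg_pos sum_nonneg mult_nonneg_nonneg) auto

text \<open>Log-sum-exp dominates each exponent; in this way a bound on the cost controls the
  loads.\<close>

lemma v_le_ln_U: "i < m \<Longrightarrow> v x i \<le> ln (U x)"
proof -
  assume "i < m"
  hence "exp (v x i) \<le> U x"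
    using member_le_sum[of i "{..<m}" "load_weight x"] load_weight_pos[of x]
    by (simp add: load_weight_def)
  thus ?thesis using weights_pos[of x] by (subst ln_ge_iff) auto
qed

lemma x_le_ln_Q: "i < m \<Longrightarrow> j < n \<Longrightarrow> x i j / \<Gamma> \<le> ln (Q x)"
proof -
  assume "i < m" "j < n"
  hence "asg_weight x (i, j) \<le> Q x"
    by (intro member_le_sum less_imp_le[OF asg_weight_pos]) auto
  thus ?thesis using weights_pos[of x] by (subst ln_ge_iff) (auto simp: asg_weight_def)
qed

lemma w_le_ln_Q: "i < m \<Longrightarrow> w x i \<le> ln (Q x)"
proof -
  assume "i < m"
  have "\<Gamma> * w x i \<le> \<Gamma> * ln (Q x)"
    using x_le_ln_Q[OF \<open>i < m\<close>, of _ x] Gamma_pos by (intro Gamma_w_le) (simp add: field_simps)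
  thus ?thesis using Gamma_pos by simp
qed

lemma ln_weights_nonneg:
  assumes "state x"
  shows "0 \<le> ln (U x)" "0 \<le> ln (Q x)"
proof -
  have "0 < m" using size_ge_2 by simp
  thus "0 \<le> ln (U x)" "0 \<le> ln (Q x)"
    using v_nonneg[OF assms, of 0] v_le_ln_U[of 0 x] w_nonneg[OF assms, of 0] w_le_ln_Q[of 0 x]
    by linarith+
qed

lemma alg_cost_parts:
  assumes "state x"
  shows "0 \<le> (\<Sum>i<m. c i * y_til I Z \<Gamma> x i)" "0 \<le> (\<Sum>i<m. \<Sum>j<n. a i j * x i j / \<Gamma>)"
  using assms Gamma_pos
  by (auto intro!: sum_nonneg mult_nonneg_nonneg divide_nonneg_nonneg
      simp: charge_nonneg asg_nonneg state_nonneg y_til_def v_nonneg w_nonneg)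

lemma potential_le_alg_cost:
  assumes "state x"
  shows "Z * (ln (U x) + ln (Q x)) \<le> alg_cost I Z \<Gamma> x"
  unfolding alg_cost_def potential_eq using alg_cost_parts[OF assms] by simp

text \<open>Up to the factor \<open>\<Gamma>\<close> the two costs differ in one term only:
  \<open>l_til\<close> is replaced by the potential, whose two logarithms dominate \<open>v\<close>
  and \<open>w\<close> in every row.\<close>

lemma trial_cost_le:
  assumes "state x"
  shows "trial_cost I Z (\<Gamma>, x) \<le> \<Gamma> * alg_cost I Z \<Gamma> x"
proof -
  have "l_til I Z \<Gamma> x \<le> potential I Z \<Gamma> x"
    unfolding l_til_def potential_eq y_til_def using index_sets_nonempty v_le_ln_U w_le_ln_Q
    by (subst Max_le_iff) (auto intro: add_mono)
  hence "Z * l_til I Z \<Gamma> x \<le> Z * potential I Z \<Gamma> x"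
    using Z_pos by simp
  thus ?thesis unfolding trial_cost_def alg_cost_def using Gamma_pos by simp
qed

text \<open>An upper bound on the sum of the growth terms of a pair. The logarithm pays for uncapped
  rounds, with factor 2 because \<open>g \<le> 2 * ln (1 + g)\<close>. The indicator pays for the
  single capped round that the client in service can have at \<open>i\<close>; afterwards it is
  replaced by 1, since the row maximum may move to another client.\<close>

definition growth_cap :: "nat option \<Rightarrow> assignment \<Rightarrow> nat \<Rightarrow> nat \<Rightarrow> real" where
  "growth_cap J x i j = (if x i j = 0 then 0
     else 2 * ln (x i j / beta) + (if J = Some j then of_bool (x i j = \<Gamma> * w x i) else 1))"

text \<open>Pays for the indicator part of the rates in row \<open>i\<close> through the growth of
  the row maximum. The maximum with \<open>beta\<close> gives level 0 to a row of zeros.\<close>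

definition charge_level :: "assignment \<Rightarrow> nat \<Rightarrow> real" where
  "charge_level x i = 2 * ln (max (\<Gamma> * w x i) beta / beta)"

text \<open>\<open>E\<close> is the sum of the parameters \<open>eps\<close> of all rounds so far, \<open>M\<close> and \<open>N\<close> bound the shares in
  the two exponential sums over all rounds so far, and \<open>A i j\<close> is the sum of the terms
  \<open>eps / rate\<close> for the pair \<open>(i, j)\<close>. \<open>J\<close> is the client in service, if any.\<close>

definition certified :: "nat option \<Rightarrow> assignment \<Rightarrow> real \<Rightarrow> bool" where
  "certified J x E \<longleftrightarrow> (\<exists>M N A.
     share_bound {..<m} (load_weight x) M \<and>
     share_bound ({..<m} \<times> {..<n}) (asg_weight x) N \<and>
     (\<forall>j<n. \<forall>i\<in>near I Z j. 0 \<le> A i j \<and> A i j \<le> growth_cap J x i j) \<and>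
     E \<le> (\<Sum>i<m. \<Sum>j<n. xs i j * (smooth_rate M N i j * A i j))
        + (\<Sum>i<m. c i / \<Gamma> * ys i * charge_level x i))"

text \<open>The share bounds only grow, so the old terms stay dominated; the new terms are dominated
  because the current shares lie below the bounds. \<open>g\<close> is the growth added in column
  \<open>j\<close>, and \<open>h\<close> is covered by the increase of the charge levels.\<close>

lemma certified_bump:
  assumes cert: "certified J x E" and j: "j < n" and \<delta>: "\<And>i. i < m \<Longrightarrow> 0 \<le> \<delta> i"
    and g: "\<And>i. i < m \<Longrightarrow> 0 \<le> g i"
    and cap: "\<And>i. i \<in> near I Z j \<Longrightarrow> growth_cap J x i j + g i \<le> growth_cap J' (bump j \<delta> x) i j"
    and cap': "\<And>i k. k < n \<Longrightarrow> k \<noteq> j \<Longrightarrow> i \<in> near I Z k \<Longrightarrow>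
      growth_cap J x i k \<le> growth_cap J' (bump j \<delta> x) i k"
    and level: "\<And>i. i < m \<Longrightarrow> charge_level x i + h i \<le> charge_level (bump j \<delta> x) i"
  shows "certified J' (bump j \<delta> x) (E
    + (\<Sum>i<m. xs i j * (smooth_rate (\<lambda>i. load_weight x i / U x) (\<lambda>ij. asg_weight x ij / Q x) i j * g i))
    + (\<Sum>i<m. c i / \<Gamma> * ys i * h i))" (is "certified J' ?x' (E + ?G + ?H)")
proof -
  obtain M N A where
    M: "share_bound {..<m} (load_weight x) M" and
    N: "share_bound ({..<m} \<times> {..<n}) (asg_weight x) N" and
    A_all: "\<forall>j<n. \<forall>i\<in>near I Z j. 0 \<le> A i j \<and> A i j \<le> growth_cap J x i j" and
    E: "E \<le> (\<Sum>i<m. \<Sum>j<n. xs i j * (smooth_rate M N i j * A i j))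
        + (\<Sum>i<m. c i / \<Gamma> * ys i * charge_level x i)"
    using cert unfolding certified_def by (elim exE conjE) (rule that)
  have A: "0 \<le> A i j" "A i j \<le> growth_cap J x i j" if "j < n" "i \<in> near I Z j" for i j
    using A_all that by auto
  obtain M' where M': "share_bound {..<m} (load_weight ?x') M'" "\<And>i. i \<in> {..<m} \<Longrightarrow> M i \<le> M' i"
  proof (rule share_bound_update[OF M, of "load_weight ?x'"])
    show "{..<m} \<noteq> {}" by (rule index_sets_nonempty)
  qed (use bump_weights(1)[OF j \<delta>] load_weight_pos in auto)
  obtain N' where N': "share_bound ({..<m} \<times> {..<n}) (asg_weight ?x') N'"
    "\<And>ij. ij \<in> {..<m} \<times> {..<n} \<Longrightarrow> N ij \<le> N' ij"
  proof (rule share_bound_update[OF N, of "asg_weight ?x'"])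
    show "{..<m} \<times> {..<n} \<noteq> {}" using index_sets_nonempty by auto
  qed (use bump_weights(2)[OF j \<delta>] asg_weight_pos in auto)
  define A' where "A' = (\<lambda>i k. A i k + (if k = j then g i else 0))"
  have rate_step: "xs i k * (smooth_rate M N i k * A i k)
      + (if k = j then xs i k * (smooth_rate (\<lambda>i. load_weight x i / U x) (\<lambda>ij. asg_weight x ij / Q x) i k * g i) else 0)
      \<le> xs i k * (smooth_rate M' N' i k * A' i k)"
    if i: "i < m" and k: "k < n" for i k
  proof (cases "i \<in> near I Z k")
    case True
    have 1: "smooth_rate M N i k \<le> smooth_rate M' N' i k"
      using M'(2) N'(2) i k by (intro smooth_rate_mono) auto
    have 2: "smooth_rate (\<lambda>i. load_weight x i / U x) (\<lambda>ij. asg_weight x ij / Q x) i k \<le> smooth_rate M' N' i k"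
    proof (intro smooth_rate_mono i k)
      show "load_weight x i / U x \<le> M' i"
        using M M'(2)[of i] i by (force simp: share_bound_def)
      have "asg_weight x (i, k) / Q x \<le> N (i, k)"
        using N i k by (simp add: share_bound_def)
      also have "\<dots> \<le> N' (i, k)" using N'(2) i k by simp
      finally show "asg_weight x (i, k) / Q x \<le> N' (i, k)" .
    qed
    have "smooth_rate M N i k * A i k
      + (if k = j then smooth_rate (\<lambda>i. load_weight x i / U x) (\<lambda>ij. asg_weight x ij / Q x) i k * g i else 0)
      \<le> smooth_rate M' N' i k * A i k + (if k = j then smooth_rate M' N' i k * g i else 0)"
      using mult_right_mono[OF 1 A(1)[OF k True]] mult_right_mono[OF 2 g[OF i]] by (auto intro: add_mono)
    also have "\<dots> = smooth_rate M' N' i k * A' i k"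
      by (simp add: A'_def distrib_left)
    finally show ?thesis
      using mult_left_mono[OF _ xs_nonneg[OF i k]] by (fastforce simp: distrib_left)
  qed (use xs_near i k in auto)
  have "E + ?G + ?H \<le> (\<Sum>i<m. \<Sum>k<n. xs i k * (smooth_rate M N i k * A i k)
      + (if k = j then xs i k * (smooth_rate (\<lambda>i. load_weight x i / U x) (\<lambda>ij. asg_weight x ij / Q x) i k * g i) else 0))
      + (\<Sum>i<m. c i / \<Gamma> * ys i * (charge_level x i + h i))"
    using E j by (simp add: sum.distrib distrib_left)
  also have "\<dots> \<le> (\<Sum>i<m. \<Sum>k<n. xs i k * (smooth_rate M' N' i k * A' i k))
      + (\<Sum>i<m. c i / \<Gamma> * ys i * charge_level ?x' i)"
    using rate_step level charge_nonneg ys_nonneg Gamma_pos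
    by (intro add_mono sum_mono mult_left_mono) auto
  finally have E': "E + ?G + ?H \<le> \<dots>" .
  moreover have "0 \<le> A' i k \<and> A' i k \<le> growth_cap J' ?x' i k" if "k < n" "i \<in> near I Z k" for i k
    using A[OF that] g[OF near_lt[OF that(2)]] cap[of i] cap'[OF that(1) _ that(2)] that
    by (cases "k = j") (auto simp: A'_def)
  ultimately show ?thesis
    unfolding certified_def using M'(1) N'(1) by blast
qed

lemma certified_antimono: "certified J x E \<Longrightarrow> E' \<le> E \<Longrightarrow> certified J x E'"
  unfolding certified_def by (meson order_trans)

text \<open>The indicator for the client in service is at most 1, the value used for all other
  clients.\<close>

lemma certified_finish:
  assumes "certified J x E"
  shows "certified None x E"
proof -
  have "growth_cap J x i j \<le> growth_cap None x i j" for i j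
    by (simp add: growth_cap_def)
  with assms show ?thesis unfolding certified_def by (meson order_trans)
qed

lemma charge_level_mono: "\<Gamma> * w x i \<le> \<Gamma> * w x' i \<Longrightarrow> charge_level x i \<le> charge_level x' i"
  unfolding charge_level_def using beta_pos
  by (intro mult_left_mono) (auto intro!: divide_right_mono simp: max_def)

subsection \<open>Arrival of a client\<close>

lemma arrive_eq_bump:
  assumes "\<And>i. i < m \<Longrightarrow> x i j = 0"
  shows "arrive I Z j x = bump j (\<lambda>i. if i \<in> near I Z j then x_init I i j else 0) x"
  using assms near_lt by (fastforce simp: arrive_def bump_def fun_eq_iff)

lemma x_init_nonneg: "i < m \<Longrightarrow> j < n \<Longrightarrow> 0 \<le> x_init I i j"
  using x_init_ge_beta beta_pos by (meson less_imp_le order_trans)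

lemma x_init_le_1: "i < m \<Longrightarrow> j < n \<Longrightarrow> x_init I i j \<le> 1"
proof -
  assume "i < m" "j < n"
  moreover have "1 / (2 * real m * real n) \<le> 1"
    using frac_le[of 1 1 1 "2 * real m * real n"] size_prod_ge_4 by simp
  ultimately show ?thesis using x_init_le by (meson order_trans)
qed

lemma arrive_state:
  assumes "state x" "j < n" "\<And>i. i < m \<Longrightarrow> x i j = 0"
  shows "state (arrive I Z j x)"
proof -
  have "x_init I i j \<le> 2" if "i < m" for i
    using x_init_le_1[OF that assms(2)] by simp
  thus ?thesis using assms x_init_ge_beta by (auto simp: state_def arrive_def)
qed

text \<open>No round takes place, so \<open>E\<close> stays. The zero column had caps 0, and its new
  caps are nonnegative because \<open>x_init\<close> is at least \<open>beta\<close>.\<close>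

lemma arrive_certified:
  assumes "certified None x E" "state x" "j < n" "\<And>i. i < m \<Longrightarrow> x i j = 0"
  shows "certified (Some j) (arrive I Z j x) E"
proof -
  define \<delta> where "\<delta> = (\<lambda>i. if i \<in> near I Z j then x_init I i j else 0)"
  have \<delta>: "0 \<le> \<delta> i" if "i < m" for i
    using that x_init_nonneg assms by (simp add: \<delta>_def)
  have "certified (Some j) (bump j \<delta> x) (E
    + (\<Sum>i<m. xs i j * (smooth_rate (\<lambda>i. load_weight x i / U x) (\<lambda>ij. asg_weight x ij / Q x) i j * 0))
    + (\<Sum>i<m. c i / \<Gamma> * ys i * 0))"
  proof (rule certified_bump[OF assms(1,3) \<delta>])
    fix i assume i: "i \<in> near I Z j"
    have "bump j \<delta> x i j = x_init I i j"
      using i assms near_lt[OF i] by (simp add: bump_def \<delta>_def)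
    moreover have "beta \<le> x_init I i j" using near_lt[OF i] x_init_ge_beta assms by simp
    ultimately show "growth_cap None x i j + 0 \<le> growth_cap (Some j) (bump j \<delta> x) i j"
      using assms near_lt[OF i] beta_pos by (simp add: growth_cap_def)
  next
    fix i k assume "k \<noteq> j"
    thus "growth_cap None x i k \<le> growth_cap (Some j) (bump j \<delta> x) i k"
      by (simp add: growth_cap_def bump_def)
  next
    fix i assume "i < m"
    thus "charge_level x i + 0 \<le> charge_level (bump j \<delta> x) i"
      using \<delta> by (simp add: charge_level_mono w_bump_mono)
  qed auto
  moreover have "arrive I Z j x = bump j \<delta> x"
    using assms by (simp add: arrive_eq_bump \<delta>_def)
  ultimately show ?thesis by simp
qed

text \<open>With \<open>b = 1 / (2 m n)\<close>, each logarithm rises by at most \<open>b\<close>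
  and each facility adds at most \<open>3 * Z * b\<close> to the linear terms. As
  \<open>m \<ge> 2\<close>, this is at most \<open>Z / (2 n) + 3 Z / (2 n)\<close>.\<close>

lemma arrive_cost:
  assumes "state x" "j < n" "\<And>i. i < m \<Longrightarrow> x i j = 0"
  shows "alg_cost I Z \<Gamma> (arrive I Z j x) \<le> alg_cost I Z \<Gamma> x + 2 * Z / real n"
proof -
  define \<delta> where "\<delta> = (\<lambda>i. if i \<in> near I Z j then x_init I i j else 0)"
  define b where "b = 1 / (2 * real m * real n)"
  have b: "0 < b" using size_ge_2 by (simp add: b_def)
  have \<delta>: "0 \<le> \<delta> i" "\<delta> i \<le> b" if "i < m" for i
    using that x_init_nonneg x_init_le assms b by (auto simp: \<delta>_def b_def)
  have parts: "p i j * \<delta> i \<le> Z * b" "c i * \<delta> i \<le> Z * b" "a i j * \<delta> i \<le> Z * b"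
      "c i * p i j * \<delta> i / Z \<le> Z * b" if i: "i < m" for i
  proof -
    have nn: "0 \<le> p i j * \<delta> i" "0 \<le> c i * \<delta> i" "0 \<le> a i j * \<delta> i"
      using demand_nonneg charge_nonneg asg_nonneg \<delta> i assms by auto
    have sum: "p i j * \<delta> i + c i * \<delta> i + a i j * \<delta> i \<le> Z * b"
      using x_init_total_le[of i j] assms(2) b Z_pos
      by (auto simp: \<delta>_def b_def total_def distrib_right)
    show le: "p i j * \<delta> i \<le> Z * b" "c i * \<delta> i \<le> Z * b" "a i j * \<delta> i \<le> Z * b"
      using nn sum by auto
    \<comment> \<open>The product is reduced to the demand term by the bound
      \<open>c i \<le> Z\<close> for a near facility.\<close>
    show "c i * p i j * \<delta> i / Z \<le> Z * b"
    proof (cases "i \<in> near I Z j")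
      case True
      have "c i * (p i j * \<delta> i) \<le> Z * (Z * b)"
        by (rule mult_mono[OF near_le(1)[OF True assms(2)] le(1)]) (use nn Z_pos in auto)
      thus ?thesis using Z_pos by (simp add: pos_divide_le_eq mult_ac)
    qed (use Z_pos b in \<open>simp add: \<delta>_def\<close>)
  qed
  have "ln (U (bump j \<delta> x)) \<le> ln (U x) + b"
  proof -
    have "p i j * \<delta> i / (Z * \<Gamma>) \<le> b" if "i < m" for i
    proof -
      have "p i j * \<delta> i \<le> b * (Z * 1)" using parts(1)[OF that] by (simp add: mult.commute)
      also have "\<dots> \<le> b * (Z * \<Gamma>)" using b Z_pos Gamma_ge_1 by (intro mult_left_mono) auto
      finally show ?thesis using Z_pos Gamma_pos by (simp add: pos_divide_le_eq)
    qed
    thus ?thesis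
      unfolding load_weight_def v_bump[OF assms(2)] using index_sets_nonempty
      by (intro ln_sum_exp_shift_le) auto
  qed
  moreover have "ln (Q (bump j \<delta> x)) \<le> ln (Q x) + b"
  proof -
    have "\<delta> i / \<Gamma> \<le> b" if "i < m" for i
    proof -
      have "\<delta> i \<le> b * 1" using \<delta>[OF that] by simp
      also have "\<dots> \<le> b * \<Gamma>" using b Gamma_ge_1 by (intro mult_left_mono) auto
      finally show ?thesis using Gamma_pos by (simp add: pos_divide_le_eq)
    qed
    hence "ln (\<Sum>ij\<in>{..<m}\<times>{..<n}. exp (x (fst ij) (snd ij) / \<Gamma> + (if snd ij = j then \<delta> (fst ij) / \<Gamma> else 0)))
        \<le> ln (\<Sum>ij\<in>{..<m}\<times>{..<n}. exp (x (fst ij) (snd ij) / \<Gamma>)) + b"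
      using index_sets_nonempty b by (intro ln_sum_exp_shift_le) auto
    moreover have "exp (x (fst ij) (snd ij) / \<Gamma> + (if snd ij = j then \<delta> (fst ij) / \<Gamma> else 0))
        = asg_weight (bump j \<delta> x) ij" for ij
      by (simp add: asg_weight_def bump_def add_divide_distrib split: prod.splits)
    moreover have "exp (x (fst ij) (snd ij) / \<Gamma>) = asg_weight x ij" for ij
      by (simp add: asg_weight_def split: prod.splits)
    ultimately show ?thesis by simp
  qed
  moreover have "\<Gamma> * w (bump j \<delta> x) i \<le> \<Gamma> * w x i + \<delta> i" if "i < m" for i
    using \<delta>[OF that] le_Gamma_w[OF assms(2), of x i] by (intro w_bump_le) auto
  ultimately have "alg_cost I Z \<Gamma> (bump j \<delta> x) \<le> alg_cost I Z \<Gamma> x + Z * (b + b)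
    + (\<Sum>i<m. (c i * p i j * \<delta> i / Z + c i * \<delta> i + a i j * \<delta> i) / \<Gamma>)"
    by (rule alg_cost_bump[OF assms(2)])
  also have "(\<Sum>i<m. (c i * p i j * \<delta> i / Z + c i * \<delta> i + a i j * \<delta> i) / \<Gamma>) \<le> (\<Sum>i<m. 3 * (Z * b))"
  proof (intro sum_mono)
    fix i assume "i \<in> {..<m}"
    hence i: "i < m" by simp
    have "0 \<le> 3 * (Z * b)" using Z_pos b by simp
    have "c i * p i j * \<delta> i / Z + c i * \<delta> i + a i j * \<delta> i \<le> 3 * (Z * b) * 1"
      using parts[OF i] by simp
    also have "\<dots> \<le> 3 * (Z * b) * \<Gamma>"
      using Gamma_ge_1 \<open>0 \<le> 3 * (Z * b)\<close> by (rule mult_left_mono)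
    finally show "(c i * p i j * \<delta> i / Z + c i * \<delta> i + a i j * \<delta> i) / \<Gamma> \<le> 3 * (Z * b)"
      using Gamma_pos by (simp add: pos_divide_le_eq)
  qed
  also have "Z * (b + b) = Z / (real m * real n)" by (simp add: b_def)
  also have "\<dots> \<le> Z / (2 * real n)"
    using size_ge_2 Z_pos by (intro divide_left_mono mult_right_mono) auto
  also have "(\<Sum>i<m. 3 * (Z * b)) = 3 * Z / (2 * real n)"
    using size_ge_2 by (simp add: b_def)
  finally have "alg_cost I Z \<Gamma> (bump j \<delta> x) \<le> alg_cost I Z \<Gamma> x + (Z / (2 * real n) + 3 * Z / (2 * real n))"
    by simp
  also have "Z / (2 * real n) + 3 * Z / (2 * real n) = 2 * Z / real n"
    using size_ge_2 by (simp add: field_simps)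
  finally have "alg_cost I Z \<Gamma> (bump j \<delta> x) \<le> alg_cost I Z \<Gamma> x + 2 * Z / real n" .
  moreover have "arrive I Z j x = bump j \<delta> x"
    unfolding \<delta>_def by (intro arrive_eq_bump assms)
  ultimately show ?thesis by simp
qed

end

text \<open>The source of the factor 2 in \<open>growth_cap\<close> and \<open>charge_level\<close>:
  it converts growth into the increase of a logarithm.\<close>

lemma half_le_ln_1_plus:
  fixes g :: real
  assumes "0 \<le> g" "g \<le> 1"
  shows "g \<le> 2 * ln (1 + g)"
proof -
  have "g / 2 \<le> g / (1 + g)"
    using assms by (intro divide_left_mono) auto
  also have "\<dots> \<le> ln (1 + g)"
    using one_minus_inverse_le_ln[of 1 "1 + g"] assms by simp
  finally show ?thesis by simp
qed

context trial begin

subsection \<open>One round of the while loop\<close>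

definition in_service :: "nat \<Rightarrow> assignment \<Rightarrow> bool" where
  "in_service j x \<longleftrightarrow> state x \<and> (\<forall>i\<in>near I Z j. beta \<le> x i j)"

lemma raise_step_near:
  assumes "i \<in> near I Z j"
  shows "raise_step I Z \<Gamma> j x i j = (if x i j < \<Gamma> * w x i
    then min (\<Gamma> * w x i) (x i j * (1 + growth x i j)) else x i j * (1 + growth x i j))"
  using assms Gamma_pos by (simp add: raise_step_def growth_def Let_def pos_divide_less_eq mult.commute)

lemma raise_step_eq_bump:
  "raise_step I Z \<Gamma> j x = bump j (\<lambda>i. raise_step I Z \<Gamma> j x i j - x i j) x"
  by (auto simp: bump_def fun_eq_iff raise_step_def)

context
  fixes x :: assignment and j :: nat and \<delta> :: "nat \<Rightarrow> real"
  assumes j: "j < n" and serv: "in_service j x" and sum_lt: "(\<Sum>i<m. x i j) < 1"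
  defines "\<delta> \<equiv> \<lambda>i. raise_step I Z \<Gamma> j x i j - x i j"
begin

lemma serving_state: "state x"
  using serv by (simp add: in_service_def)

lemma x_bounds:
  assumes "i < m"
  shows "0 \<le> x i j" "x i j < 1"
proof -
  show "0 \<le> x i j" by (intro state_nonneg serving_state assms j)
  have "x i j \<le> (\<Sum>i<m. x i j)"
    using assms j serving_state by (intro member_le_sum) (auto intro: state_nonneg)
  thus "x i j < 1" using sum_lt by simp
qed

lemma growth_le_1: "i < m \<Longrightarrow> growth x i j \<le> 1"
  using growth_bounds(2)[OF _ j, of i x] mu_bounds by simp

lemma delta_bounds:
  assumes "i < m"
  shows "0 \<le> \<delta> i" "\<delta> i \<le> x i j * growth x i j"
proof -
  have "0 \<le> x i j * growth x i j"
    using x_bounds growth_bounds(1)[OF assms j, of x] assms by simp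
  hence "0 \<le> \<delta> i \<and> \<delta> i \<le> x i j * growth x i j"
    using raise_step_near[of i j x] by (cases "i \<in> near I Z j")
      (auto simp: \<delta>_def distrib_left min_def raise_step_def)
  thus "0 \<le> \<delta> i" "\<delta> i \<le> x i j * growth x i j" by auto
qed

lemma delta_not_near: "i \<notin> near I Z j \<Longrightarrow> \<delta> i = 0"
  by (simp add: \<delta>_def raise_step_def)

lemma delta_at_max:
  assumes "i \<in> near I Z j" "x i j = \<Gamma> * w x i"
  shows "x i j + \<delta> i = x i j * (1 + growth x i j)"
  using raise_step_near[OF assms(1)] assms(2) by (simp add: \<delta>_def)

lemma delta_below_max:
  assumes "i \<in> near I Z j" "x i j \<noteq> \<Gamma> * w x i"
  shows "x i j + \<delta> i = min (\<Gamma> * w x i) (x i j * (1 + growth x i j))"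
  using raise_step_near[OF assms(1), of x] le_Gamma_w[OF j, of x i] assms(2) by (simp add: \<delta>_def)

lemma w_raise_at_max:
  assumes "i \<in> near I Z j" "x i j = \<Gamma> * w x i"
  shows "\<Gamma> * w (bump j \<delta> x) i = x i j * (1 + growth x i j)"
proof (rule antisym)
  have "x i j \<le> x i j + \<delta> i" using delta_bounds near_lt assms by simp
  thus "\<Gamma> * w (bump j \<delta> x) i \<le> x i j * (1 + growth x i j)"
    using delta_at_max[OF assms] assms by (intro w_bump_le) simp_all
  have "bump j \<delta> x i j \<le> \<Gamma> * w (bump j \<delta> x) i" by (rule le_Gamma_w[OF j])
  thus "x i j * (1 + growth x i j) \<le> \<Gamma> * w (bump j \<delta> x) i"
    by (simp add: bump_def delta_at_max[OF assms])
qed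

text \<open>A capped entry cannot exceed the old row maximum, so the maximum moves only if the entry
  of client \<open>j\<close> attains it.\<close>

lemma w_raise_le:
  assumes "i < m"
  shows "\<Gamma> * w (bump j \<delta> x) i \<le> \<Gamma> * w x i + \<delta> i * of_bool (x i j = \<Gamma> * w x i)"
proof (cases "i \<in> near I Z j")
  case True
  show ?thesis
    using w_raise_at_max[OF True] delta_at_max[OF True] delta_below_max[OF True]
      w_bump_le[of x i "\<Gamma> * w x i" j \<delta>] by (cases "x i j = \<Gamma> * w x i") auto
next
  case False
  thus ?thesis using w_bump_le[of x i "\<Gamma> * w x i" j \<delta>] le_Gamma_w[OF j, of x i]
    by (simp add: delta_not_near)
qed

lemma raise_bump: "raise_step I Z \<Gamma> j x = bump j \<delta> x"
  using raise_step_eq_bump[of j x] by (simp add: \<delta>_def)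

lemma raise_in_service: "in_service j (raise_step I Z \<Gamma> j x)"
proof -
  have "x i j + \<delta> i \<le> 2" if "i < m" for i
  proof -
    have "x i j * growth x i j \<le> 1 * 1"
      using x_bounds[OF that] growth_le_1[OF that] growth_bounds(1)[OF that j, of x]
      by (intro mult_mono) auto
    thus ?thesis using delta_bounds[OF that] x_bounds[OF that] by simp
  qed
  moreover have "beta \<le> x i j + \<delta> i" if "i \<in> near I Z j" for i
    using delta_bounds(1)[OF near_lt[OF that]] serv that by (force simp: in_service_def)
  moreover have "x i j = 0" if "i < m" "i \<notin> near I Z j" for i
    using serv j that by (simp add: in_service_def state_def)
  moreover from calculation have "x i j + \<delta> i = 0 \<or> beta \<le> x i j + \<delta> i" if "i < m" for i
    using that delta_not_near by (cases "i \<in> near I Z j") auto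
  ultimately show ?thesis
    using serv j by (auto simp: in_service_def state_def raise_bump bump_def delta_not_near)
qed

lemma ln_full_growth:
  assumes "i \<in> near I Z j"
  shows "2 * ln (x i j / beta) + growth x i j \<le> 2 * ln (x i j * (1 + growth x i j) / beta)"
proof -
  have "beta \<le> x i j" using serv assms by (simp add: in_service_def)
  hence "0 < x i j" using beta_pos by simp
  moreover have g: "0 < growth x i j" "growth x i j \<le> 1"
    using growth_le_1 growth_bounds(1)[OF _ j] near_lt assms by auto
  ultimately have "ln (x i j / beta * (1 + growth x i j)) = ln (x i j / beta) + ln (1 + growth x i j)"
    using beta_pos by (intro ln_mult_pos) auto
  thus ?thesis using half_le_ln_1_plus[of "growth x i j"] g by simp
qed

text \<open>A capped round may fall short of the factor \<open>1 + growth\<close>, but it makes \<open>x i j\<close> the maximum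
  of its row, and then no later round for client \<open>j\<close> is capped at \<open>i\<close>.\<close>

lemma growth_cap_raise:
  assumes "i \<in> near I Z j"
  shows "growth_cap (Some j) x i j + growth x i j \<le> growth_cap (Some j) (bump j \<delta> x) i j"
proof -
  have beta: "beta \<le> x i j" using serv assms by (simp add: in_service_def)
  hence pos: "0 < x i j" using beta_pos by simp
  have i: "i < m" using assms by (rule near_lt)
  have \<delta>: "0 \<le> \<delta> i" using delta_bounds i by simp
  have new: "bump j \<delta> x i j = x i j + \<delta> i" by (simp add: bump_def)
  \<comment> \<open>Without capping the logarithm pays for the growth, and the indicator cannot
    switch off, because an entry that attains the row maximum keeps doing so when it grows.\<close>
  have full: ?thesis if eq: "x i j + \<delta> i = x i j * (1 + growth x i j)"
  proof -
    have cap: "growth_cap (Some j) y i j = 2 * ln (y i j / beta) + of_bool (y i j = \<Gamma> * w y i)"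
      if "y i j \<noteq> 0" for y
      using that by (simp add: growth_cap_def)
    have "of_bool (x i j = \<Gamma> * w x i)
        \<le> (of_bool (x i j * (1 + growth x i j) = \<Gamma> * w (bump j \<delta> x) i) :: real)"
      using w_raise_at_max[OF assms] by auto
    moreover have nz: "bump j \<delta> x i j \<noteq> 0" using pos \<delta> by (simp add: new)
    have "growth_cap (Some j) (bump j \<delta> x) i j = 2 * ln (x i j * (1 + growth x i j) / beta)
        + of_bool (x i j * (1 + growth x i j) = \<Gamma> * w (bump j \<delta> x) i)"
      using cap[of "bump j \<delta> x", OF nz] by (simp only: new eq)
    moreover have "growth_cap (Some j) x i j = 2 * ln (x i j / beta) + of_bool (x i j = \<Gamma> * w x i)"
      using cap[of x] pos by simp
    ultimately show ?thesis
      using ln_full_growth[OF assms] by linarith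
  qed
  show ?thesis
  proof (cases "x i j = \<Gamma> * w x i \<or> x i j * (1 + growth x i j) \<le> \<Gamma> * w x i")
    case True
    thus ?thesis using full delta_at_max[OF assms] delta_below_max[OF assms]
      by (cases "x i j = \<Gamma> * w x i") auto
  next
    case False
    \<comment> \<open>In the capped case the indicator jumps from 0 to 1 and pays for a growth of at
      most 1, while the logarithm does not fall.\<close>
    hence max: "x i j + \<delta> i = \<Gamma> * w x i" using delta_below_max[OF assms] by simp
    have "\<Gamma> * w (bump j \<delta> x) i = x i j + \<delta> i"
    proof (rule antisym)
      show "\<Gamma> * w (bump j \<delta> x) i \<le> x i j + \<delta> i" by (rule w_bump_le) (simp_all add: max)
      show "x i j + \<delta> i \<le> \<Gamma> * w (bump j \<delta> x) i"
        using le_Gamma_w[OF j, of "bump j \<delta> x" i] by (simp only: new)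
    qed
    moreover have "ln (x i j / beta) \<le> ln ((x i j + \<delta> i) / beta)"
      using pos beta_pos \<delta> by (simp add: divide_right_mono)
    ultimately show ?thesis
      using False growth_le_1[OF i] pos \<delta> by (simp add: growth_cap_def new)
  qed
qed

text \<open>If the entry of client \<open>j\<close> is the row maximum, it is not capped and moves
  the maximum by the factor \<open>1 + growth\<close>; otherwise the maximum does not fall.\<close>

lemma charge_level_raise:
  assumes "i < m"
  shows "charge_level x i + growth x i j * of_bool (i \<in> near I Z j \<and> x i j = \<Gamma> * w x i)
    \<le> charge_level (bump j \<delta> x) i"
proof (cases "i \<in> near I Z j \<and> x i j = \<Gamma> * w x i")
  case True
  hence beta: "beta \<le> x i j" using serv unfolding in_service_def by blast
  have "x i j \<le> x i j * (1 + growth x i j)"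
    using beta beta_pos growth_bounds(1)[OF assms j, of x] by simp
  hence "beta \<le> x i j * (1 + growth x i j)" using beta by simp
  hence "charge_level (bump j \<delta> x) i = 2 * ln (x i j * (1 + growth x i j) / beta)"
    using w_raise_at_max[of i] True unfolding charge_level_def by (simp only: max_absorb1)
  moreover have "charge_level x i = 2 * ln (x i j / beta)"
    using beta True[THEN conjunct2, symmetric] by (simp add: charge_level_def max_absorb1)
  moreover have "of_bool (i \<in> near I Z j \<and> x i j = \<Gamma> * w x i) = (1 :: real)"
    using True by simp
  ultimately show ?thesis
    using ln_full_growth[of i] True by simp
next
  case False
  have "charge_level x i \<le> charge_level (bump j \<delta> x) i"
    by (intro charge_level_mono w_bump_mono delta_bounds assms)
  moreover have "of_bool (i \<in> near I Z j \<and> x i j = \<Gamma> * w x i) = (0 :: real)"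
    using False by simp
  ultimately show ?thesis by auto
qed

text \<open>Since the LP solution serves client \<open>j\<close>, \<open>eps\<close> is at most the
  sum of \<open>xs i j * eps\<close>, in which each \<open>eps\<close> is rewritten as growth times
  rate. The smooth part of the rate is charged to the pair, the indicator part to the row.\<close>

lemma raise_certified:
  assumes "certified (Some j) x E"
  shows "certified (Some j) (raise_step I Z \<Gamma> j x) (E + eps I Z \<Gamma> x j)"
proof -
  define sr where "sr = (\<lambda>i. smooth_rate (\<lambda>i. load_weight x i / U x) (\<lambda>ij. asg_weight x ij / Q x) i j)"
  define h where "h = (\<lambda>i. growth x i j * of_bool (i \<in> near I Z j \<and> x i j = \<Gamma> * w x i))"
  have "certified (Some j) (bump j \<delta> x) (E + (\<Sum>i<m. xs i j * (sr i * growth x i j))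
      + (\<Sum>i<m. c i / \<Gamma> * ys i * h i))"
    unfolding sr_def
  proof (rule certified_bump[OF assms j delta_bounds(1)])
    fix i k assume "k \<noteq> j"
    thus "growth_cap (Some j) x i k \<le> growth_cap (Some j) (bump j \<delta> x) i k"
      by (simp add: growth_cap_def bump_def)
  qed (use growth_bounds(1)[OF _ j, of _ x] growth_cap_raise charge_level_raise in \<open>auto simp: h_def intro: less_imp_le\<close>)
  moreover have "eps I Z \<Gamma> x j \<le> (\<Sum>i<m. xs i j * (sr i * growth x i j)) + (\<Sum>i<m. c i / \<Gamma> * ys i * h i)"
  proof -
    have "eps I Z \<Gamma> x j * 1 \<le> eps I Z \<Gamma> x j * (\<Sum>i<m. xs i j)"
      using eps_pos[OF j, of x] xs_sum[OF j] by (intro mult_left_mono) auto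
    also have "\<dots> = (\<Sum>i<m. xs i j * (growth x i j * r x i j))"
      unfolding sum_distrib_left by (intro sum.cong) (use growth_bounds(3)[OF _ j, of _ x] in auto)
    also have "\<dots> \<le> (\<Sum>i<m. xs i j * (sr i * growth x i j) + c i / \<Gamma> * ys i * h i)"
    proof (intro sum_mono)
      fix i assume "i \<in> {..<m}"
      hence i: "i < m" by simp
      have hn: "0 \<le> h i" using growth_bounds(1)[OF i j, of x] by (simp add: h_def)
      \<comment> \<open>A facility that is not near has \<open>xs i j = 0\<close>, so restricting
        \<open>h\<close> to near facilities loses nothing.\<close>
      have "xs i j * (growth x i j * r x i j) = xs i j * (sr i * growth x i j) + c i / \<Gamma> * xs i j * h i"
        using xs_near[OF i j] by (cases "i \<in> near I Z j")
          (auto simp: rate_eq[OF i j] sr_def h_def algebra_simps)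
      \<comment> \<open>\<open>ys i\<close> does not depend on the client, so what row
        \<open>i\<close> is charged by all clients is collected in one charge level.\<close>
      also have "\<dots> \<le> xs i j * (sr i * growth x i j) + c i / \<Gamma> * ys i * h i"
        using hn charge_nonneg[OF i] Gamma_pos xs_le_ys[OF i j]
        by (intro add_left_mono mult_right_mono mult_left_mono) auto
      finally show "xs i j * (growth x i j * r x i j) \<le> xs i j * (sr i * growth x i j) + c i / \<Gamma> * ys i * h i" .
    qed
    finally show ?thesis by (simp add: sum.distrib)
  qed
  ultimately show ?thesis
    unfolding raise_bump by (elim certified_antimono) simp
qed

text \<open>The first-order change of the cost is at most the sum of rate times
  \<open>\<delta> i\<close>, hence at most the sum of \<open>x i j * eps\<close>, hence at most
  \<open>eps\<close> because client \<open>j\<close> is not fully served yet. The factor 9 covers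
  the nonlinearity of the logarithms.\<close>

lemma raise_cost:
  assumes "alg_cost I Z \<Gamma> x \<le> 7 * Z * log_emn I"
  shows "alg_cost I Z \<Gamma> (raise_step I Z \<Gamma> j x) \<le> alg_cost I Z \<Gamma> x + 9 * eps I Z \<Gamma> x j"
proof -
  define su where "su = (\<lambda>i. load_weight x i / U x)"
  define sq where "sq = (\<lambda>i. asg_weight x (i, j) / Q x)"
  define at_max where "at_max = (\<lambda>i. of_bool (x i j = \<Gamma> * w x i) :: real)"
  have "Z * (ln (U x) + ln (Q x)) \<le> Z * (7 * log_emn I)"
    using potential_le_alg_cost[OF serving_state] assms by simp
  hence pot: "ln (U x) + ln (Q x) \<le> 7 * log_emn I" using Z_pos by simp
  have d1: "0 \<le> p i j * \<delta> i / (Z * \<Gamma>)" "p i j * \<delta> i / (Z * \<Gamma>) \<le> 2" if i: "i < m" for i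
  proof -
    show "0 \<le> p i j * \<delta> i / (Z * \<Gamma>)"
      using delta_bounds[OF i] demand_nonneg[OF i j] Z_pos Gamma_pos by simp
    have "p i j * \<delta> i \<le> p i j * (x i j * (mu I - 1))"
      using delta_bounds[OF i] growth_bounds(2)[OF i j, of x] x_bounds[OF i] demand_nonneg[OF i j]
      by (meson mult_left_mono order_trans)
    also have "\<dots> = (mu I - 1) * (p i j * x i j)" by simp
    also have "\<dots> \<le> (mu I - 1) * (\<Sum>k<n. p i k * x i k)"
      using mu_bounds i j demand_nonneg state_nonneg[OF serving_state]
      by (intro mult_left_mono member_le_sum) auto
    finally have "p i j * \<delta> i / (Z * \<Gamma>) \<le> (mu I - 1) * v x i"
      using Z_pos Gamma_pos unfolding v_til_def times_divide_eq_right
      by (intro divide_right_mono) auto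
    \<comment> \<open>The cost bound limits the load, and the choice of \<open>mu\<close> makes the
      increment of the exponent at most \<open>7 / 6\<close>, within the range of the
      linearization.\<close>
    also have "\<dots> \<le> (mu I - 1) * (7 * log_emn I)"
      using pot v_le_ln_U[OF i, of x] ln_weights_nonneg[OF serving_state] mu_bounds
      by (intro mult_left_mono) auto
    also have "\<dots> = 7 / 6"
      using log_emn_ge_2 by (simp add: mu_def)
    finally show "p i j * \<delta> i / (Z * \<Gamma>) \<le> 2" by linarith
  qed
  have d2: "0 \<le> \<delta> i / \<Gamma>" "\<delta> i / \<Gamma> \<le> 2" if i: "i < m" for i
  proof -
    show "0 \<le> \<delta> i / \<Gamma>" using delta_bounds[OF i] Gamma_pos by simp
    have "\<delta> i \<le> 1 * 1"
      using delta_bounds[OF i] x_bounds[OF i] growth_le_1[OF i] growth_bounds(1)[OF i j, of x]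
      by (meson less_imp_le mult_mono order_trans zero_le_one)
    also have "\<dots> \<le> 2 * \<Gamma>" using Gamma_ge_1 by simp
    finally show "\<delta> i / \<Gamma> \<le> 2" using Gamma_pos by (simp add: pos_divide_le_eq)
  qed
  have "ln (U (bump j \<delta> x)) \<le> ln (U x) + 9 * (\<Sum>i<m. su i * (p i j * \<delta> i / (Z * \<Gamma>)))"
    unfolding su_def load_weight_def v_bump[OF j] using index_sets_nonempty d1
    by (intro ln_sum_exp_increase_le) auto
  moreover have "ln (Q (bump j \<delta> x)) \<le> ln (Q x) + 9 * (\<Sum>i<m. sq i * (\<delta> i / \<Gamma>))"
  proof -
    define f where "f = (\<lambda>(i, k). x i k / \<Gamma>)"
    define d where "d = (\<lambda>(i, k). if k = j then \<delta> i / \<Gamma> else 0)"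
    have f: "asg_weight x ij = exp (f ij)" "asg_weight (bump j \<delta> x) ij = exp (f ij + d ij)" for ij
      by (auto simp: asg_weight_def f_def d_def bump_def add_divide_distrib split: prod.splits)
    have d: "0 \<le> d ij" "d ij \<le> 2" if "ij \<in> {..<m} \<times> {..<n}" for ij
      using that d2 by (auto simp: d_def)
    have "ln (Q (bump j \<delta> x)) \<le> ln (Q x) + 9 * (\<Sum>ij\<in>{..<m}\<times>{..<n}. asg_weight x ij / Q x * d ij)"
      unfolding f using index_sets_nonempty d by (intro ln_sum_exp_increase_le) auto
    also have "(\<Sum>ij\<in>{..<m}\<times>{..<n}. asg_weight x ij / Q x * d ij)
        = (\<Sum>i<m. \<Sum>k<n. if k = j then sq i * (\<delta> i / \<Gamma>) else 0)"
      unfolding sum.cartesian_product by (intro sum.cong) (auto simp: d_def sq_def)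
    finally show ?thesis using j by simp
  qed
  ultimately have "alg_cost I Z \<Gamma> (bump j \<delta> x) \<le> alg_cost I Z \<Gamma> x
    + Z * (9 * (\<Sum>i<m. su i * (p i j * \<delta> i / (Z * \<Gamma>))) + 9 * (\<Sum>i<m. sq i * (\<delta> i / \<Gamma>)))
    + (\<Sum>i<m. (c i * p i j * \<delta> i / Z + c i * (\<delta> i * at_max i) + a i j * \<delta> i) / \<Gamma>)"
    by (rule alg_cost_bump[OF j]) (simp add: w_raise_le at_max_def)
  also have "Z * (9 * (\<Sum>i<m. su i * (p i j * \<delta> i / (Z * \<Gamma>))) + 9 * (\<Sum>i<m. sq i * (\<delta> i / \<Gamma>)))
      = (\<Sum>i<m. 9 * ((p i j * su i + Z * sq i) / \<Gamma> * \<delta> i))"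
    using Z_pos by (simp add: sum_distrib_left distrib_left sum.distrib add_divide_distrib distrib_right mult_ac)
  \<comment> \<open>The linear terms are given the factor 9 as well, so that all parts combine to
    the full rate.\<close>
  also have "(\<Sum>i<m. (c i * p i j * \<delta> i / Z + c i * (\<delta> i * at_max i) + a i j * \<delta> i) / \<Gamma>)
      \<le> (\<Sum>i<m. 9 * ((c i * p i j / Z + c i * at_max i + a i j) / \<Gamma> * \<delta> i))"
  proof (intro sum_mono)
    fix i assume "i \<in> {..<m}"
    hence i: "i < m" by simp
    define s where "s = (c i * p i j / Z + c i * at_max i + a i j) / \<Gamma> * \<delta> i"
    have "0 \<le> s"
      using charge_nonneg[OF i] demand_nonneg[OF i j] asg_nonneg[OF i j] delta_bounds[OF i] Z_pos Gamma_pos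
      by (simp add: s_def at_max_def)
    moreover have "(c i * p i j * \<delta> i / Z + c i * (\<delta> i * at_max i) + a i j * \<delta> i) / \<Gamma> = s"
      by (simp add: s_def algebra_simps add_divide_distrib)
    ultimately have "(c i * p i j * \<delta> i / Z + c i * (\<delta> i * at_max i) + a i j * \<delta> i) / \<Gamma> \<le> 9 * s"
      by simp
    thus "(c i * p i j * \<delta> i / Z + c i * (\<delta> i * at_max i) + a i j * \<delta> i) / \<Gamma>
        \<le> 9 * ((c i * p i j / Z + c i * at_max i + a i j) / \<Gamma> * \<delta> i)" by (simp only: s_def)
  qed
  finally have "alg_cost I Z \<Gamma> (bump j \<delta> x) \<le> alg_cost I Z \<Gamma> x
      + ((\<Sum>i<m. 9 * ((p i j * su i + Z * sq i) / \<Gamma> * \<delta> i))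
      + (\<Sum>i<m. 9 * ((c i * p i j / Z + c i * at_max i + a i j) / \<Gamma> * \<delta> i)))"
    by simp
  also have "(\<Sum>i<m. 9 * ((p i j * su i + Z * sq i) / \<Gamma> * \<delta> i))
      + (\<Sum>i<m. 9 * ((c i * p i j / Z + c i * at_max i + a i j) / \<Gamma> * \<delta> i))
      = 9 * (\<Sum>i<m. r x i j * \<delta> i)"
    unfolding sum.distrib[symmetric] sum_distrib_left
    by (intro sum.cong) (auto simp: rate_eq[OF _ j] smooth_rate_def su_def sq_def at_max_def
        algebra_simps add_divide_distrib)
  also have "(\<Sum>i<m. r x i j * \<delta> i) \<le> (\<Sum>i<m. x i j * eps I Z \<Gamma> x j)"
  proof (intro sum_mono)
    fix i assume "i \<in> {..<m}"
    hence i: "i < m" by simp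
    have "r x i j * \<delta> i \<le> r x i j * (x i j * growth x i j)"
      using delta_bounds[OF i] rate_pos[OF i j, of x] by (intro mult_left_mono) auto
    also have "\<dots> = x i j * eps I Z \<Gamma> x j"
      using growth_bounds(3)[OF i j, of x] by (simp add: mult_ac)
    finally show "r x i j * \<delta> i \<le> x i j * eps I Z \<Gamma> x j" .
  qed
  also have "(\<Sum>i<m. x i j * eps I Z \<Gamma> x j) \<le> eps I Z \<Gamma> x j"
    using sum_lt eps_pos[OF j, of x] by (simp add: mult_le_cancel_right1 flip: sum_distrib_right)
  finally show ?thesis by (simp add: raise_bump)
qed

end

end

text \<open>\<open>E\<close> accompanies the state without being computed from it. It gains at least
  \<open>e\<close> per iteration but stays below \<open>B\<close> while the loop runs, so the number
  of iterations is finite.\<close>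

lemma while_option_terminates:
  fixes e B E\<^sub>0 :: real
  assumes init: "P E\<^sub>0 s" and e: "0 < e"
    and step: "\<And>E s. P E s \<Longrightarrow> b s \<Longrightarrow> \<exists>E'\<ge>E + e. P E' (c s)"
    and bound: "\<And>E s. P E s \<Longrightarrow> b s \<Longrightarrow> E \<le> B"
  obtains t E where "while_option b c s = Some t" "P E t" "\<not> b t"
proof -
  have "\<exists>k. \<not> b ((c ^^ k) s)"
  proof (rule ccontr)
    assume "\<not> ?thesis"
    hence b: "b ((c ^^ k) s)" for k by simp
    have "\<exists>E\<ge>E\<^sub>0 + real k * e. P E ((c ^^ k) s)" for k
    proof (induction k)
      case (Suc k)
      then obtain E where "E\<^sub>0 + real k * e \<le> E" "P E ((c ^^ k) s)" by blast
      with step[OF _ b] obtain E' where "E + e \<le> E'" "P E' ((c ^^ Suc k) s)" by fastforce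
      thus ?case using \<open>E\<^sub>0 + real k * e \<le> E\<close> by (intro exI[of _ E']) (simp add: distrib_right)
    qed (use init in auto)
    hence "E\<^sub>0 + real k * e \<le> B" for k
      using bound b by (meson order_trans)
    moreover obtain k where "(B - E\<^sub>0) / e < real k" using reals_Archimedean2 by blast
    hence "B - E\<^sub>0 < real k * e" using e by (simp add: pos_divide_less_eq)
    ultimately show False by (smt (verit))
  qed
  then obtain t where t: "while_option b c s = Some t" by (auto simp: while_option_def)
  have "\<exists>E. P E t"
    by (rule while_option_rule[where P = "\<lambda>s. \<exists>E. P E s", OF _ t]) (use step init in blast)+
  thus ?thesis using that t while_option_stop[OF t] by blast
qed

context trial begin

subsection \<open>The certificate bounds the total increase\<close>

abbreviation "L \<equiv> ln (real m * real n * rho I)"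

lemma L_ge_1: "1 \<le> L"
proof -
  have "ln (real m * real n) \<le> L"
    using size_prod_ge_4 rho_ge_1 mult_left_mono[of 1 "rho I" "real m * real n"] by simp
  thus ?thesis using ln_size_ge_1 by linarith
qed

text \<open>\<open>2 / beta\<close> is \<open>4 * (m n \<rho>)\<close> and
  \<open>4 \<le> m n \<rho>\<close>, so its logarithm is at most \<open>2 * L\<close>. The remaining
  1 is at most \<open>L\<close>.\<close>

lemma growth_total_le: "2 * ln (2 / beta) + 1 \<le> 5 * L"
proof -
  have four: "4 * 1 \<le> real m * real n * rho I"
    using size_prod_ge_4 rho_ge_1 by (intro mult_mono) auto
  hence pos: "0 < real m * real n * rho I" by linarith
  have "ln 4 \<le> L" using four pos by simp
  moreover have "2 / beta = 4 * (real m * real n * rho I)"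
    by (simp add: beta_def)
  hence "ln (2 / beta) = ln 4 + L"
    using pos by (simp only: ln_mult_pos zero_less_numeral)
  ultimately show ?thesis using L_ge_1 by simp
qed

lemma growth_cap_le:
  assumes "state x" "i < m" "j < n"
  shows "growth_cap J x i j \<le> 5 * L"
proof (cases "x i j = 0")
  case False
  hence "beta \<le> x i j" "x i j \<le> 2" using assms by (auto simp: state_def)
  hence "ln (x i j / beta) \<le> ln (2 / beta)"
    using beta_pos by (simp add: divide_right_mono)
  moreover have "growth_cap J x i j \<le> 2 * ln (x i j / beta) + 1"
    using False by (simp add: growth_cap_def)
  ultimately show ?thesis using growth_total_le by linarith
qed (use L_ge_1 in \<open>simp add: growth_cap_def\<close>)

lemma charge_level_le:
  assumes "state x" "i < m"
  shows "charge_level x i \<le> 5 * L"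
proof -
  have "\<Gamma> * w x i \<le> 2" using assms by (intro Gamma_w_le) (auto simp: state_def)
  hence "max (\<Gamma> * w x i) beta \<le> 2" using beta_le_1 by simp
  hence "max (\<Gamma> * w x i) beta / beta \<le> 2 / beta"
    using beta_pos by (intro divide_right_mono) auto
  moreover have "0 < max (\<Gamma> * w x i) beta / beta" using beta_pos by (simp add: less_max_iff_disj)
  ultimately have "ln (max (\<Gamma> * w x i) beta / beta) \<le> ln (2 / beta)"
    using beta_pos by (subst ln_le_cancel_iff) auto
  thus ?thesis using growth_total_le by (simp add: charge_level_def)
qed

text \<open>Each part of the smooth rates turns into a part of the LP objective: the load of
  \<open>i\<close> is at most \<open>Z * ys i\<close>, and both \<open>ys i\<close> and
  \<open>xs i j\<close> are at most \<open>ls\<close>.\<close>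

lemma weighted_smooth_rate_le:
  assumes M: "\<And>i. i < m \<Longrightarrow> 0 \<le> M i" and N: "\<And>ij. ij \<in> {..<m} \<times> {..<n} \<Longrightarrow> 0 \<le> N ij"
  shows "(\<Sum>i<m. \<Sum>j<n. xs i j * smooth_rate M N i j)
    \<le> (Z * ls * sum M {..<m} + Z * ls * sum N ({..<m} \<times> {..<n})
      + (\<Sum>i<m. c i * ys i) + (\<Sum>i<m. \<Sum>j<n. a i j * xs i j)) / \<Gamma>"
proof -
  have load: "(\<Sum>j<n. p i j * xs i j) \<le> Z * ys i" if "i < m" for i
    using that by (rule xs_load)
  have "(\<Sum>i<m. \<Sum>j<n. xs i j * smooth_rate M N i j)
    = ((\<Sum>i<m. M i * (\<Sum>j<n. p i j * xs i j)) + (\<Sum>i<m. \<Sum>j<n. Z * xs i j * N (i, j))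
      + (\<Sum>i<m. c i / Z * (\<Sum>j<n. p i j * xs i j)) + (\<Sum>i<m. \<Sum>j<n. a i j * xs i j)) / \<Gamma>"
    unfolding smooth_rate_def
    by (simp add: sum_distrib_left sum_divide_distrib sum.distrib algebra_simps add_divide_distrib)
  also have "\<dots> \<le> ((\<Sum>i<m. M i * (Z * ls)) + (\<Sum>i<m. \<Sum>j<n. Z * ls * N (i, j))
      + (\<Sum>i<m. c i * ys i) + (\<Sum>i<m. \<Sum>j<n. a i j * xs i j)) / \<Gamma>"
  proof (intro divide_right_mono add_mono sum_mono order_refl)
    fix i assume "i \<in> {..<m}"
    hence i: "i < m" by simp
    have "Z * ys i \<le> Z * ls" using ys_le_ls[OF i] Z_pos by simp
    thus "M i * (\<Sum>j<n. p i j * xs i j) \<le> M i * (Z * ls)"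
      using load[OF i] M[OF i] by (intro mult_left_mono) auto
    have "c i / Z * (\<Sum>j<n. p i j * xs i j) \<le> c i / Z * (Z * ys i)"
      using load[OF i] charge_nonneg[OF i] Z_pos by (intro mult_left_mono) auto
    thus "c i / Z * (\<Sum>j<n. p i j * xs i j) \<le> c i * ys i" using Z_pos by simp
    fix j assume "j \<in> {..<n}"
    hence j: "j < n" by simp
    have "xs i j \<le> ls" using xs_le_ys[OF i j] ys_le_ls[OF i] by simp
    thus "Z * xs i j * N (i, j) \<le> Z * ls * N (i, j)"
      using N[of "(i, j)"] i j Z_pos by (intro mult_right_mono mult_left_mono) auto
  qed (use Gamma_pos in simp)
  also have "(\<Sum>i<m. \<Sum>j<n. Z * ls * N (i, j)) = Z * ls * sum N ({..<m} \<times> {..<n})"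
    by (simp add: sum.cartesian_product sum_distrib_left case_prod_unfold)
  also have "(\<Sum>i<m. M i * (Z * ls)) = Z * ls * sum M {..<m}"
    by (simp add: sum_distrib_left mult_ac)
  finally show ?thesis .
qed

text \<open>All growth sums and charge levels are at most \<open>5 * L\<close>, and each sum of
  share bounds is at most 1 plus a logarithm, which explains the 2.\<close>

lemma certified_le:
  assumes cert: "certified J x E" and x: "state x"
  shows "E \<le> 5 * L * obj * (2 + ln (U x) + ln (Q x)) / \<Gamma>"
proof -
  obtain M N A where
    M: "share_bound {..<m} (load_weight x) M" and
    N: "share_bound ({..<m} \<times> {..<n}) (asg_weight x) N" and
    A: "\<forall>j<n. \<forall>i\<in>near I Z j. 0 \<le> A i j \<and> A i j \<le> growth_cap J x i j" and
    E: "E \<le> (\<Sum>i<m. \<Sum>j<n. xs i j * (smooth_rate M N i j * A i j))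
        + (\<Sum>i<m. c i / \<Gamma> * ys i * charge_level x i)"
    using cert unfolding certified_def by (elim exE conjE) (rule that)
  define C where "C = (\<Sum>i<m. c i * ys i)"
  define D where "D = (\<Sum>i<m. \<Sum>j<n. a i j * xs i j)"
  have CD: "0 \<le> C" "0 \<le> D" "0 \<le> Z * ls"
    using charge_nonneg ys_nonneg asg_nonneg xs_nonneg Z_pos ls_ge_1
    by (auto simp: C_def D_def intro!: sum_nonneg)
  have Mn: "0 \<le> M i" if "i < m" for i
  proof -
    have "0 \<le> load_weight x i / U x"
      using weights_pos[of x] load_weight_pos[of x i] by simp
    also have "\<dots> \<le> M i" using M that by (simp add: share_bound_def)
    finally show ?thesis .
  qed
  have Nn: "0 \<le> N ij" if "ij \<in> {..<m} \<times> {..<n}" for ij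
  proof -
    have "0 \<le> asg_weight x ij / Q x"
      using weights_pos[of x] asg_weight_pos[of x ij] by simp
    also have "\<dots> \<le> N ij" using N that unfolding share_bound_def by blast
    finally show ?thesis .
  qed
  have "(\<Sum>i<m. \<Sum>j<n. xs i j * (smooth_rate M N i j * A i j))
      \<le> (\<Sum>i<m. \<Sum>j<n. 5 * L * (xs i j * smooth_rate M N i j))"
  proof (intro sum_mono)
    fix i j assume "i \<in> {..<m}" "j \<in> {..<n}"
    hence ij: "i < m" "j < n" by auto
    show "xs i j * (smooth_rate M N i j * A i j) \<le> 5 * L * (xs i j * smooth_rate M N i j)"
    proof (cases "i \<in> near I Z j")
      case True
      have "0 \<le> smooth_rate M N i j"
        using Mn[OF ij(1)] Nn[of "(i, j)"] ij charge_nonneg demand_nonneg asg_nonneg Z_pos Gamma_pos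
        by (simp add: smooth_rate_def)
      moreover have "A i j \<le> 5 * L"
        using A True ij growth_cap_le[OF x ij] by (meson order_trans)
      ultimately have "xs i j * smooth_rate M N i j * A i j \<le> xs i j * smooth_rate M N i j * (5 * L)"
        using xs_nonneg[OF ij] by (intro mult_left_mono) auto
      thus ?thesis by (simp add: mult_ac)
    qed (use xs_near ij in simp)
  qed
  also have "\<dots> = 5 * L * (\<Sum>i<m. \<Sum>j<n. xs i j * smooth_rate M N i j)"
    by (simp add: sum_distrib_left)
  also have "\<dots> \<le> 5 * L * ((Z * ls * sum M {..<m} + Z * ls * sum N ({..<m} \<times> {..<n}) + C + D) / \<Gamma>)"
    unfolding C_def D_def using L_ge_1 by (intro mult_left_mono weighted_smooth_rate_le Mn Nn) auto
  finally have 1: "(\<Sum>i<m. \<Sum>j<n. xs i j * (smooth_rate M N i j * A i j)) \<le> \<dots>" .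
  have "(\<Sum>i<m. c i / \<Gamma> * ys i * charge_level x i) \<le> (\<Sum>i<m. c i / \<Gamma> * ys i * (5 * L))"
    using charge_nonneg ys_nonneg charge_level_le[OF x] Gamma_pos
    by (intro sum_mono mult_left_mono) auto
  also have "\<dots> = 5 * L * (C / \<Gamma>)"
    by (simp add: C_def sum_distrib_left sum_divide_distrib mult_ac)
  finally have 2: "(\<Sum>i<m. c i / \<Gamma> * ys i * charge_level x i) \<le> 5 * L * (C / \<Gamma>)" .
  define G where "G = 2 + ln (U x) + ln (Q x)"
  have G: "2 \<le> G" using ln_weights_nonneg[OF x] by (simp add: G_def)
  have "Z * ls * (sum M {..<m} + sum N ({..<m} \<times> {..<n})) \<le> Z * ls * G"
    using CD M N by (intro mult_left_mono) (auto simp: G_def share_bound_def)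
  \<comment> \<open>The charges occur twice, from the demand part of the rates and from the charge
    levels; \<open>G \<ge> 2\<close> absorbs both.\<close>
  moreover have "C * 2 \<le> C * G" "D * 1 \<le> D * G" using G CD by (intro mult_left_mono; simp)+
  ultimately have 3: "Z * ls * sum M {..<m} + Z * ls * sum N ({..<m} \<times> {..<n}) + C + D + C \<le> obj * G"
    by (simp add: lp1_objective_def C_def D_def algebra_simps)
  have "E \<le> 5 * L * ((Z * ls * sum M {..<m} + Z * ls * sum N ({..<m} \<times> {..<n}) + C + D) / \<Gamma>)
      + 5 * L * (C / \<Gamma>)"
    using E 1 2 by linarith
  also have "\<dots> = 5 * L / \<Gamma> * (Z * ls * sum M {..<m} + Z * ls * sum N ({..<m} \<times> {..<n}) + C + D + C)"
    by (simp add: algebra_simps add_divide_distrib)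
  also have "\<dots> \<le> 5 * L / \<Gamma> * (obj * G)"
    using 3 L_ge_1 Gamma_pos by (intro mult_left_mono) auto
  finally show ?thesis by (simp add: G_def mult_ac)
qed

text \<open>The potential is at most \<open>16 * log_emn I\<close> and the summand 2 at most one
  further \<open>log_emn I\<close>, which gives \<open>85 = 5 * 17\<close>.\<close>

lemma certified_le_log:
  assumes cert: "certified J x E" and x: "state x" and cost: "alg_cost I Z \<Gamma> x \<le> 16 * Z * log_emn I"
  shows "E \<le> 85 * L * obj * log_emn I / \<Gamma>"
proof -
  have "Z * (ln (U x) + ln (Q x)) \<le> Z * (16 * log_emn I)"
    using potential_le_alg_cost[OF x] cost by simp
  hence "2 + ln (U x) + ln (Q x) \<le> 17 * log_emn I" using Z_pos log_emn_ge_2 by simp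
  hence "5 * L * obj / \<Gamma> * (2 + ln (U x) + ln (Q x)) \<le> 5 * L * obj / \<Gamma> * (17 * log_emn I)"
    using L_ge_1 obj_ge Z_pos Gamma_pos by (intro mult_left_mono) auto
  thus ?thesis using certified_le[OF cert x] by (simp add: mult_ac)
qed

text \<open>Between the budget \<open>2 * Z * log_emn I\<close> and the failure threshold, at least
  \<open>3 * Z * log_emn I\<close> of the cost must come from rounds. Comparison with the bound on
  \<open>E\<close> cancels \<open>log_emn I\<close> and leaves
  \<open>255 = 9 * 85 / 3\<close>.\<close>

lemma failure_bound:
  assumes "certified J x E" "state x" "alg_cost I Z \<Gamma> x \<le> 16 * Z * log_emn I"
    and "5 * Z * log_emn I < alg_cost I Z \<Gamma> x" "alg_cost I Z \<Gamma> x \<le> 2 * Z * log_emn I + 9 * E"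
  shows "\<Gamma> * Z \<le> 255 * L * obj"
proof -
  have "3 * Z * log_emn I \<le> 9 * (85 * L * obj * log_emn I / \<Gamma>)"
    using assms certified_le_log[OF assms(1-3)] by linarith
  also have "\<dots> = 3 * (255 * L * obj / \<Gamma>) * log_emn I"
    by simp
  finally have "3 * Z \<le> 3 * (255 * L * obj / \<Gamma>)"
    by (rule mult_right_le_imp_le) (use log_emn_ge_2 in simp)
  thus ?thesis using Gamma_pos by (simp add: field_simps)
qed

subsection \<open>Serving the clients of a trial\<close>

text \<open>FAIL is tested only after a round, so an arrival may lift the cost above the threshold;
  7 instead of 5 leaves room for this. In that case the served amount is below 1, so a round follows
  before the loop can end. The round that fails adds at most \<open>9 * Z\<close>, hence the
  16.\<close>

definition round_inv :: "assignment \<Rightarrow> nat \<Rightarrow> real \<Rightarrow> real \<Rightarrow> assignment \<times> bool \<Rightarrow> bool" where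
  "round_inv x\<^sub>0 j B E = (\<lambda>(x, failed).
     in_service j x \<and> certified (Some j) x E \<and> alg_cost I Z \<Gamma> x \<le> B + 9 * E \<and>
     (\<forall>i k. k \<noteq> j \<longrightarrow> x i k = x\<^sub>0 i k) \<and>
     (if failed then 5 * Z * log_emn I < alg_cost I Z \<Gamma> x \<and> alg_cost I Z \<Gamma> x \<le> 16 * Z * log_emn I
      else alg_cost I Z \<Gamma> x \<le> 7 * Z * log_emn I \<and>
        ((\<Sum>i<m. x i j) < 1 \<or> alg_cost I Z \<Gamma> x \<le> 5 * Z * log_emn I)))"

lemma Z_log_ge: "2 * Z \<le> Z * log_emn I"
  using mult_left_mono[OF log_emn_ge_2, of Z] Z_pos by simp

lemma eps_le_Z:
  assumes "j < n"
  shows "eps I Z \<Gamma> x j \<le> Z"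
proof -
  obtain i where i: "i \<in> near I Z j" using near_nonempty assms by blast
  have "eps I Z \<Gamma> x j \<le> (mu I - 1) * r x i j" by (rule eps_le[OF near_lt[OF i]])
  also have "\<dots> \<le> 1 / 12 * (5 * Z)"
    using mu_bounds rate_le[OF i assms, of x] rate_pos[OF near_lt[OF i] assms, of x]
    by (intro mult_mono) auto
  finally show ?thesis using Z_pos by simp
qed

text \<open>The share of a pair is at least \<open>1 / Q x\<close>, and the cost bounds
  \<open>Q x\<close>. The exponentially small bound serves only termination.\<close>

lemma eps_lower_bound:
  assumes x: "state x" and j: "j < n" and cost: "alg_cost I Z \<Gamma> x \<le> 7 * Z * log_emn I"
  shows "(mu I - 1) * (Z / exp (7 * log_emn I) / \<Gamma>) \<le> eps I Z \<Gamma> x j"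
proof (rule eps_ge)
  fix i assume i: "i < m"
  have "Z * (ln (U x) + ln (Q x)) \<le> Z * (7 * log_emn I)"
    using potential_le_alg_cost[OF x] cost by simp
  hence "ln (Q x) \<le> 7 * log_emn I"
    using Z_pos ln_weights_nonneg[OF x] by simp
  hence "exp (ln (Q x)) \<le> exp (7 * log_emn I)" by simp
  hence Q: "Q x \<le> exp (7 * log_emn I)" using weights_pos[of x] by simp
  have "1 \<le> asg_weight x (i, j)"
    using state_nonneg[OF x i j] Gamma_pos by (simp add: asg_weight_def)
  hence "1 / exp (7 * log_emn I) \<le> asg_weight x (i, j) / Q x"
    using Q weights_pos[of x] by (intro frac_le) auto
  hence "Z * (1 / exp (7 * log_emn I)) / \<Gamma> \<le> Z * (asg_weight x (i, j) / Q x) / \<Gamma>"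
    using Z_pos Gamma_pos by (intro divide_right_mono mult_left_mono) auto
  thus "Z / exp (7 * log_emn I) / \<Gamma> \<le> r x i j"
    using rate_ge[OF i j, of x] by simp
qed

lemma round_inv_step:
  assumes inv: "round_inv x\<^sub>0 j B E (x, False)" and j: "j < n" and lt: "(\<Sum>i<m. x i j) < 1"
  defines "x' \<equiv> raise_step I Z \<Gamma> j x"
  shows "round_inv x\<^sub>0 j B (E + eps I Z \<Gamma> x j) (x', alg_cost I Z \<Gamma> x' > 5 * Z * log_emn I)"
proof -
  have serv: "in_service j x" and cert: "certified (Some j) x E"
    and cost: "alg_cost I Z \<Gamma> x \<le> B + 9 * E" "alg_cost I Z \<Gamma> x \<le> 7 * Z * log_emn I"
    and other: "\<forall>i k. k \<noteq> j \<longrightarrow> x i k = x\<^sub>0 i k"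
    using inv by (auto simp: round_inv_def)
  have "alg_cost I Z \<Gamma> x' \<le> alg_cost I Z \<Gamma> x + 9 * eps I Z \<Gamma> x j"
    unfolding x'_def by (rule raise_cost[OF j serv lt cost(2)])
  moreover have "alg_cost I Z \<Gamma> x' \<le> 16 * (Z * log_emn I)"
    using calculation cost(2) eps_le_Z[OF j, of x] Z_log_ge Z_pos by linarith
  moreover have "5 * (Z * log_emn I) \<le> 7 * (Z * log_emn I)" using Z_log_ge Z_pos by linarith
  moreover have "\<forall>i k. k \<noteq> j \<longrightarrow> x' i k = x\<^sub>0 i k"
    using other by (simp add: x'_def raise_step_def)
  ultimately show ?thesis
    using raise_in_service[OF j serv lt] raise_certified[OF j serv lt cert] cost
    by (auto simp: round_inv_def x'_def)
qed

text \<open>\<open>E\<close> rises by a fixed positive amount per round while the certificate bounds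
  it, so the loop ends. The initial values leave the sum of the client below 1, so at least one
  round with a test for failure takes place.\<close>

lemma serve_terminates:
  assumes x: "state x" and cert: "certified None x E" and j: "j < n"
    and zero: "\<And>i. i < m \<Longrightarrow> x i j = 0"
    and cost: "alg_cost I Z \<Gamma> x \<le> B + 9 * E" "alg_cost I Z \<Gamma> x \<le> 5 * Z * log_emn I"
  obtains x' failed E' where "serve I Z \<Gamma> j x = Some (x', failed)"
    "round_inv x j (B + 2 * Z / real n) E' (x', failed)"
    "failed \<or> 1 \<le> (\<Sum>i<m. x' i j)"
proof -
  let ?B = "B + 2 * Z / real n"
  let ?b = "\<lambda>(y, failed). \<not> failed \<and> (\<Sum>i<m. y i j) < 1"
  let ?c = "\<lambda>(y, failed). let y' = raise_step I Z \<Gamma> j y in (y', alg_cost I Z \<Gamma> y' > 5 * Z * log_emn I)"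
  have n: "2 * Z / real n \<le> 2 * Z / 1"
    using size_ge_2 Z_pos by (intro divide_left_mono) auto
  have "(\<Sum>i<m. arrive I Z j x i j) \<le> (\<Sum>i<m. 1 / (2 * real m * real n))"
    using x_init_le[OF _ j] zero by (intro sum_mono) (auto simp: arrive_def)
  also have "\<dots> = 1 / (2 * real n)" using size_ge_2 by simp
  also have "\<dots> < 1" using size_ge_2 by simp
  finally have start: "(\<Sum>i<m. arrive I Z j x i j) < 1" .
  have arr: "alg_cost I Z \<Gamma> (arrive I Z j x) \<le> alg_cost I Z \<Gamma> x + 2 * Z / real n"
    by (rule arrive_cost[OF x j zero])
  have "alg_cost I Z \<Gamma> (arrive I Z j x) \<le> 7 * Z * log_emn I"
    using arr cost n Z_log_ge Z_pos by linarith
  hence "round_inv x j ?B E (arrive I Z j x, False)"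
    using arrive_certified[OF cert x j zero] arr arrive_state[OF x j zero]
      cost start x_init_ge_beta[OF near_lt j]
    by (auto simp: round_inv_def in_service_def arrive_def)
  moreover have "0 < (mu I - 1) * (Z / exp (7 * log_emn I) / \<Gamma>)"
    using mu_bounds Z_pos Gamma_pos by simp
  moreover have "\<exists>E'\<ge>E + (mu I - 1) * (Z / exp (7 * log_emn I) / \<Gamma>). round_inv x j ?B E' (?c s)"
    if inv: "round_inv x j ?B E s" and b: "?b s" for E s
  proof -
    obtain y where s: "s = (y, False)" using b by (cases s) auto
    have "state y" "alg_cost I Z \<Gamma> y \<le> 7 * Z * log_emn I"
      using inv by (auto simp: s round_inv_def in_service_def)
    from eps_lower_bound[OF this(1) j this(2)] round_inv_step[OF inv[unfolded s] j] b
    show ?thesis by (intro exI[of _ "E + eps I Z \<Gamma> y j"]) (simp add: s Let_def)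
  qed
  moreover have "E \<le> 85 * L * obj * log_emn I / \<Gamma>" if inv: "round_inv x j ?B E s" for E s
  proof -
    obtain y f where s: "s = (y, f)" by (cases s)
    have "alg_cost I Z \<Gamma> y \<le> 7 * Z * log_emn I \<or> alg_cost I Z \<Gamma> y \<le> 16 * Z * log_emn I"
      using inv by (auto simp: s round_inv_def split: if_splits)
    hence "alg_cost I Z \<Gamma> y \<le> 16 * Z * log_emn I" using Z_log_ge Z_pos by linarith
    thus ?thesis using inv by (intro certified_le_log[of "Some j" y]) (auto simp: s round_inv_def in_service_def)
  qed
  ultimately obtain t E' where t: "while_option ?b ?c (arrive I Z j x, False) = Some t"
    "round_inv x j ?B E' t" "\<not> ?b t"
    by (rule while_option_terminates)
  show ?thesis
    using that[of "fst t" "snd t" E'] t by (cases t) (auto simp: serve_def)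
qed

text \<open>The certificate and \<open>E\<close> are carried on from client to client. The budget
  consists of the initial potential, \<open>2 * Z / n\<close> per arrival and \<open>9 * E\<close>;
  all clients missing from \<open>js\<close> count as arrived, including those of earlier
  trials.\<close>

lemma assign_clients_spec:
  assumes "state x" "certified None x E" "\<And>i j. j \<in> set js \<Longrightarrow> i < m \<Longrightarrow> x i j = 0"
    and "distinct js" "set js \<subseteq> {..<n}"
    and "alg_cost I Z \<Gamma> x
      \<le> 2 * Z * ln (real m * real n) + 2 * Z * (real n - real (length js)) / real n + 9 * E"
    and "alg_cost I Z \<Gamma> x \<le> 5 * Z * log_emn I"
  shows "\<exists>x' js'. assign_clients I Z \<Gamma> js x = Some (x', js') \<and> state x' \<and>
    alg_cost I Z \<Gamma> x' \<le> 16 * Z * log_emn I \<and>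
    (\<forall>i k. k \<notin> set js \<longrightarrow> x' i k = x i k) \<and>
    (\<exists>us. js = us @ js' \<and> (\<forall>j\<in>set us. 1 \<le> (\<Sum>i<m. x' i j))) \<and>
    (js' \<noteq> [] \<longrightarrow> \<Gamma> * Z \<le> 255 * L * obj)"
  using assms
proof (induction js arbitrary: x E)
  case Nil
  have "alg_cost I Z \<Gamma> x \<le> 16 * Z * log_emn I"
    using Nil.prems(7) Z_log_ge Z_pos by linarith
  thus ?case using Nil.prems(1) by simp
next
  case (Cons j js)
  define B where "B = 2 * Z * ln (real m * real n) + 2 * Z * (real n - real (length (j # js))) / real n"
  have j: "j < n" and zero: "\<And>i. i < m \<Longrightarrow> x i j = 0" using Cons.prems by auto
  have n0: "real n \<noteq> 0" using j by simp
  obtain x' failed E' where x': "serve I Z \<Gamma> j x = Some (x', failed)"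
    "round_inv x j (B + 2 * Z / real n) E' (x', failed)" "failed \<or> 1 \<le> (\<Sum>i<m. x' i j)"
    using serve_terminates[OF Cons.prems(1,2) j zero, of B] Cons.prems(6,7) unfolding B_def by blast
  have B: "B + 2 * Z / real n
      = 2 * Z * ln (real m * real n) + 2 * Z * (real n - real (length js)) / real n"
    using n0 by (simp add: B_def field_simps)
  have st: "state x'" and cert: "certified (Some j) x' E'" and cost: "alg_cost I Z \<Gamma> x' \<le> B + 2 * Z / real n + 9 * E'"
    and other: "\<And>i k. k \<noteq> j \<Longrightarrow> x' i k = x i k"
    using x'(2) by (auto simp: round_inv_def in_service_def)
  show ?case
  proof (cases failed)
    case True
    have fail: "5 * Z * log_emn I < alg_cost I Z \<Gamma> x'" "alg_cost I Z \<Gamma> x' \<le> 16 * Z * log_emn I"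
      using x'(2) True by (auto simp: round_inv_def)
    \<comment> \<open>All arrivals together contribute at most \<open>2 * Z\<close>, which completes
      \<open>ln (m n)\<close> to \<open>log_emn I\<close>.\<close>
    have "2 * Z * (real n - real (length js)) / real n \<le> 2 * Z * real n / real n"
      using Z_pos by (intro divide_right_mono mult_left_mono) auto
    also have "\<dots> = 2 * Z" using n0 by simp
    finally have "alg_cost I Z \<Gamma> x' \<le> 2 * Z * log_emn I + 9 * E'"
      using cost unfolding B log_emn_eq by (simp add: algebra_simps)
    hence "\<Gamma> * Z \<le> 255 * L * obj" by (rule failure_bound[OF cert st fail(2,1)])
    thus ?thesis using x'(1) True st fail other by simp
  next
    case False
    have served: "1 \<le> (\<Sum>i<m. x' i j)" using x'(3) False by simp
    have cost5: "alg_cost I Z \<Gamma> x' \<le> 5 * Z * log_emn I"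
      using x'(2) False served by (auto simp: round_inv_def)
    have zero': "x' i k = 0" if "k \<in> set js" "i < m" for i k
      using that Cons.prems(3,4) other by (metis distinct.simps(2) list.set_intros(2))
    have "\<exists>y js'. assign_clients I Z \<Gamma> js x' = Some (y, js') \<and> state y \<and>
        alg_cost I Z \<Gamma> y \<le> 16 * Z * log_emn I \<and>
        (\<forall>i k. k \<notin> set js \<longrightarrow> y i k = x' i k) \<and>
        (\<exists>us. js = us @ js' \<and> (\<forall>j\<in>set us. 1 \<le> (\<Sum>i<m. y i j))) \<and>
        (js' \<noteq> [] \<longrightarrow> \<Gamma> * Z \<le> 255 * L * obj)"
      by (rule Cons.IH[OF st certified_finish[OF cert] zero' _ _ cost[unfolded B] cost5])
        (use Cons.prems in auto)
    then obtain y js' us where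
      y: "assign_clients I Z \<Gamma> js x' = Some (y, js')" "state y" "alg_cost I Z \<Gamma> y \<le> 16 * Z * log_emn I"
        "\<forall>i k. k \<notin> set js \<longrightarrow> y i k = x' i k"
        "js' \<noteq> [] \<longrightarrow> \<Gamma> * Z \<le> 255 * L * obj" "js = us @ js'" "\<forall>j\<in>set us. 1 \<le> (\<Sum>i<m. y i j)"
      by (elim exE conjE) (rule that)
    have "1 \<le> (\<Sum>i<m. y i j)" using served y(4) Cons.prems(4) by simp
    hence "\<exists>us. j # js = us @ js' \<and> (\<forall>k\<in>set us. 1 \<le> (\<Sum>i<m. y i k))"
      using y(6,7) by (intro exI[of _ "j # us"]) simp
    moreover have "assign_clients I Z \<Gamma> (j # js) x = Some (y, js')"
      using x'(1) False y(1) by simp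
    moreover have "\<forall>i k. k \<notin> set (j # js) \<longrightarrow> y i k = x i k"
      using y(4) other by simp
    ultimately show ?thesis using y(2,3,5) by blast
  qed
qed

text \<open>A trial starts with zero variables and \<open>E = 0\<close>. Both logarithms are
  nonnegative there, so the shares themselves serve as the initial share bounds.\<close>

lemma trial_spec:
  assumes js: "distinct js" "set js \<subseteq> {..<n}"
  obtains x js' us where "assign_clients I Z \<Gamma> js (\<lambda>i j. 0) = Some (x, js')"
    "js = us @ js'" "\<And>j. j \<in> set us \<Longrightarrow> 1 \<le> (\<Sum>i<m. x i j)"
    "\<And>i j. i < m \<Longrightarrow> j < n \<Longrightarrow> 0 \<le> x i j"
    "\<And>i j. i < m \<Longrightarrow> j < n \<Longrightarrow> i \<notin> near I Z j \<Longrightarrow> x i j = 0"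
    "trial_cost I Z (\<Gamma>, x) \<le> \<Gamma> * (16 * Z * log_emn I)"
    "js' \<noteq> [] \<Longrightarrow> \<Gamma> * Z \<le> 255 * L * obj"
proof -
  define x0 :: assignment where "x0 = (\<lambda>i j. 0)"
  have w0: "w x0 i = 0" for i
    using index_sets_nonempty by (simp add: w_til_def x0_def)
  have uq: "U x0 = real m" "Q x0 = real m * real n"
    by (simp_all add: load_weight_def asg_weight_def v_til_def x0_def case_prod_unfold)
  have st: "state x0" by (simp add: state_def x0_def)
  have share: "share_bound K u (\<lambda>k. u k / sum u K)" if "0 \<le> ln (sum u K)" for K and u :: "'b \<Rightarrow> real"
    using that by (cases "sum u K = 0") (auto simp: share_bound_def simp flip: sum_divide_distrib)
  have "certified None x0 0"
    unfolding certified_def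
  proof (intro exI conjI)
    show "share_bound {..<m} (load_weight x0) (\<lambda>k. load_weight x0 k / U x0)"
      "share_bound ({..<m} \<times> {..<n}) (asg_weight x0) (\<lambda>k. asg_weight x0 k / Q x0)"
      using ln_weights_nonneg[OF st] by (auto intro: share)
    show "\<forall>j<n. \<forall>i\<in>near I Z j. 0 \<le> (0 :: real) \<and> 0 \<le> growth_cap None x0 i j"
      by (simp add: growth_cap_def x0_def)
  qed (use beta_pos in \<open>simp add: charge_level_def w0\<close>)
  moreover have "alg_cost I Z \<Gamma> x0 \<le> 2 * Z * ln (real m * real n)"
  proof -
    have "ln (real m) \<le> ln (real m * real n)"
      using size_ge_2 by simp
    hence "Z * (ln (real m) + ln (real m * real n)) \<le> Z * (2 * ln (real m * real n))"
      using Z_pos by (intro mult_left_mono) auto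
    moreover have "alg_cost I Z \<Gamma> x0 = Z * (ln (real m) + ln (real m * real n))"
      unfolding alg_cost_def potential_eq uq by (simp add: y_til_def w0 v_til_def) (simp add: x0_def)
    ultimately show ?thesis by simp
  qed
  moreover have "length js \<le> n"
    using js card_mono[of "{..<n}" "set js"] by (simp add: distinct_card)
  hence "0 \<le> 2 * Z * (real n - real (length js)) / real n" using Z_pos by simp
  moreover have "2 * Z * ln (real m * real n) \<le> 5 * Z * log_emn I"
    using Z_pos ln_size_ge_1 unfolding log_emn_eq by (simp add: algebra_simps)
  ultimately obtain x' js' where spec: "assign_clients I Z \<Gamma> js x0 = Some (x', js') \<and> state x' \<and>
      alg_cost I Z \<Gamma> x' \<le> 16 * Z * log_emn I \<and>
      (\<forall>i k. k \<notin> set js \<longrightarrow> x' i k = x0 i k) \<and>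
      (\<exists>us. js = us @ js' \<and> (\<forall>j\<in>set us. 1 \<le> (\<Sum>i<m. x' i j))) \<and>
      (js' \<noteq> [] \<longrightarrow> \<Gamma> * Z \<le> 255 * L * obj)"
    using assign_clients_spec[OF st, of 0 js] js by (fastforce simp: x0_def)
  then obtain us where us: "js = us @ js'" "\<forall>j\<in>set us. 1 \<le> (\<Sum>i<m. x' i j)" by blast
  have "trial_cost I Z (\<Gamma>, x') \<le> \<Gamma> * alg_cost I Z \<Gamma> x'" using spec by (intro trial_cost_le) simp
  also have "\<dots> \<le> \<Gamma> * (16 * Z * log_emn I)" using spec Gamma_pos by (intro mult_left_mono) auto
  finally show ?thesis
    using that[of x' js' us] spec us state_nonneg[of x'] by (auto simp: x0_def state_def)
qed

end

section \<open>Doubling\<close>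

text \<open>The factor \<open>max \<Gamma> (4 * T - \<Gamma>)\<close> bounds the sum of the parameters of all trials from \<open>\<Gamma>\<close> on,
  when trials with parameter above \<open>T\<close> do not fail.\<close>

lemma trials_from_spec:
  assumes inst: "ccfl_instance I" and Z: "0 < Z" and feasible: "lp1_feasible I Z xs ys ls"
  defines "T \<equiv> 255 * ln (real (num_fac I) * real (num_cl I) * rho I) * lp1_objective I Z xs ys ls / Z"
  assumes "1 \<le> \<Gamma>" "distinct js" "set js \<subseteq> {..<num_cl I}" "T < \<Gamma> * 2 ^ k"
  shows "\<exists>ts. trials_from I Z \<Gamma> js = Some ts \<and>
    (\<forall>(\<Gamma>', x)\<in>set ts. 1 \<le> \<Gamma>' \<and> (\<forall>i<num_fac I. \<forall>j<num_cl I. 0 \<le> x i j \<and> (i \<notin> near I Z j \<longrightarrow> x i j = 0))) \<and>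
    (\<forall>j\<in>set js. \<exists>(\<Gamma>', x)\<in>set ts. 1 \<le> (\<Sum>i<num_fac I. x i j)) \<and>
    cumulative_cost I Z ts \<le> 16 * Z * log_emn I * max \<Gamma> (4 * T - \<Gamma>)"
  using assms(5-)
\<comment> \<open>\<open>k\<close> bounds the number of further doublings until the parameter
  exceeds \<open>T\<close>, beyond which no trial fails.\<close>
proof (induction k arbitrary: \<Gamma> js rule: less_induct)
  case (less k)
  interpret trial I Z \<Gamma> xs ys ls using inst Z feasible less.prems by unfold_locales auto
  obtain x js' us where t: "assign_clients I Z \<Gamma> js (\<lambda>i j. 0) = Some (x, js')"
    "js = us @ js'" "\<And>j. j \<in> set us \<Longrightarrow> 1 \<le> (\<Sum>i<m. x i j)"
    "\<And>i j. i < m \<Longrightarrow> j < n \<Longrightarrow> 0 \<le> x i j"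
    "\<And>i j. i < m \<Longrightarrow> j < n \<Longrightarrow> i \<notin> near I Z j \<Longrightarrow> x i j = 0"
    "trial_cost I Z (\<Gamma>, x) \<le> \<Gamma> * (16 * Z * log_emn I)"
    "js' \<noteq> [] \<Longrightarrow> \<Gamma> * Z \<le> 255 * L * obj"
    by (rule trial_spec[OF less.prems(2,3)], rule that)
  have c: "trial_cost I Z (\<Gamma>, x) \<le> 16 * Z * log_emn I * \<Gamma>" using t(6) by (simp add: mult_ac)
  have pos: "0 \<le> 16 * Z * log_emn I" using Z log_emn_ge_2 by simp
  show ?case
  proof (cases "js' = []")
    case True
    have "16 * Z * log_emn I * \<Gamma> \<le> 16 * Z * log_emn I * max \<Gamma> (4 * T - \<Gamma>)"
      using pos by (intro mult_left_mono) auto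
    with c have "cumulative_cost I Z [(\<Gamma>, x)] \<le> 16 * Z * log_emn I * max \<Gamma> (4 * T - \<Gamma>)"
      by (simp add: cumulative_cost_def)
    moreover have "trials_from I Z \<Gamma> js = Some [(\<Gamma>, x)]"
      using t(1) True by (simp add: trials_from.simps[of _ _ _ js])
    moreover have "\<forall>j\<in>set js. \<exists>(\<Gamma>', x)\<in>set [(\<Gamma>, x)]. 1 \<le> (\<Sum>i<m. x i j)"
      using t(2,3) True by auto
    moreover have "\<forall>(\<Gamma>', x)\<in>set [(\<Gamma>, x)]. 1 \<le> \<Gamma>' \<and>
        (\<forall>i<m. \<forall>j<n. 0 \<le> x i j \<and> (i \<notin> near I Z j \<longrightarrow> x i j = 0))"
      using t(4,5) less.prems(1) by simp
    ultimately show ?thesis by blast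
  next
    case False
    have T: "\<Gamma> \<le> T" using t(7)[OF False] Z by (simp add: T_def field_simps)
    have k: "k \<noteq> 0" using T less.prems(4) by (cases k) auto
    hence "2 * \<Gamma> * 2 ^ (k - 1) = \<Gamma> * 2 ^ k" by (cases k) auto
    hence half: "T < 2 * \<Gamma> * 2 ^ (k - 1)" using less.prems(4) by (simp only:)
    have "\<exists>ts. trials_from I Z (2 * \<Gamma>) js' = Some ts \<and>
      (\<forall>(\<Gamma>', x)\<in>set ts. 1 \<le> \<Gamma>' \<and> (\<forall>i<m. \<forall>j<n. 0 \<le> x i j \<and> (i \<notin> near I Z j \<longrightarrow> x i j = 0))) \<and>
      (\<forall>j\<in>set js'. \<exists>(\<Gamma>', x)\<in>set ts. 1 \<le> (\<Sum>i<m. x i j)) \<and>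
      cumulative_cost I Z ts \<le> 16 * Z * log_emn I * max (2 * \<Gamma>) (4 * T - 2 * \<Gamma>)"
      by (rule less.IH[OF _ _ _ _ half]) (use k less.prems t(2) in auto)
    then obtain ts where ts: "trials_from I Z (2 * \<Gamma>) js' = Some ts"
      "\<forall>(\<Gamma>', x)\<in>set ts. 1 \<le> \<Gamma>' \<and> (\<forall>i<m. \<forall>j<n. 0 \<le> x i j \<and> (i \<notin> near I Z j \<longrightarrow> x i j = 0))"
      "\<forall>j\<in>set js'. \<exists>(\<Gamma>', x)\<in>set ts. 1 \<le> (\<Sum>i<m. x i j)"
      "cumulative_cost I Z ts \<le> 16 * Z * log_emn I * max (2 * \<Gamma>) (4 * T - 2 * \<Gamma>)"
      by blast
    have "cumulative_cost I Z ((\<Gamma>, x) # ts)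
        \<le> 16 * Z * log_emn I * (\<Gamma> + max (2 * \<Gamma>) (4 * T - 2 * \<Gamma>))"
      using c ts(4) by (simp add: cumulative_cost_def distrib_left)
    \<comment> \<open>This is where \<open>\<Gamma> \<le> T\<close> enters:
      \<open>\<Gamma> + 2 * \<Gamma> \<le> 4 * T - \<Gamma>\<close>.\<close>
    also have "\<dots> \<le> 16 * Z * log_emn I * max \<Gamma> (4 * T - \<Gamma>)"
      using pos T by (intro mult_left_mono) auto
    finally have "cumulative_cost I Z ((\<Gamma>, x) # ts) \<le> \<dots>" .
    moreover have "trials_from I Z \<Gamma> js = Some ((\<Gamma>, x) # ts)"
      using t(1) ts(1) False by (simp add: trials_from.simps[of _ _ _ js])
    moreover have "\<forall>j\<in>set js. \<exists>(\<Gamma>', x)\<in>set ((\<Gamma>, x) # ts). 1 \<le> (\<Sum>i<m. x i j)"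
      using t(2,3) ts(3) by auto
    moreover have "\<forall>(\<Gamma>', x)\<in>set ((\<Gamma>, x) # ts). 1 \<le> \<Gamma>' \<and>
        (\<forall>i<m. \<forall>j<n. 0 \<le> x i j \<and> (i \<notin> near I Z j \<longrightarrow> x i j = 0))"
      using t(4,5) ts(2) less.prems(1) by simp
    ultimately show ?thesis by blast
  qed
qed

section \<open>Combining the trials into one LP solution\<close>

lemma sum_sum_list_commute:
  fixes f :: "'a \<Rightarrow> 'b \<Rightarrow> 'c :: comm_monoid_add"
  shows "(\<Sum>j\<in>A. \<Sum>t\<leftarrow>ts. f j t) = (\<Sum>t\<leftarrow>ts. \<Sum>j\<in>A. f j t)"
  by (induction ts) (simp_all add: sum.distrib)

lemma member_le_sum_list_map:
  fixes f :: "'a \<Rightarrow> real"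
  assumes "t \<in> set ts" "\<And>t. t \<in> set ts \<Longrightarrow> 0 \<le> f t"
  shows "f t \<le> (\<Sum>t\<leftarrow>ts. f t)"
  using assms by (intro member_le_sum_list) auto

text \<open>The constraints other than covering and \<open>1 \<le> l\<close> are preserved when
  solutions are added. Covering holds because some trial serves the client fully. Of the two
  summands of \<open>y_til\<close>, \<open>w\<close> bounds the entries and \<open>v\<close> the
  load.\<close>

lemma combined_solution_feasible:
  assumes inst: "ccfl_instance I" and Z: "0 < Z"
    and valid: "\<And>\<Gamma> x. (\<Gamma>, x) \<in> set ts \<Longrightarrow> 1 \<le> \<Gamma>"
      "\<And>\<Gamma> x i j. (\<Gamma>, x) \<in> set ts \<Longrightarrow> i < num_fac I \<Longrightarrow> j < num_cl I \<Longrightarrow> 0 \<le> x i j"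
      "\<And>\<Gamma> x i j. (\<Gamma>, x) \<in> set ts \<Longrightarrow> i < num_fac I \<Longrightarrow> j < num_cl I \<Longrightarrow> i \<notin> near I Z j \<Longrightarrow> x i j = 0"
    and served: "\<And>j. j < num_cl I \<Longrightarrow> \<exists>(\<Gamma>, x)\<in>set ts. 1 \<le> (\<Sum>i<num_fac I. x i j)"
  shows "lp1_feasible I Z (sol_x ts) (sol_y I Z ts) (sol_l I Z ts)"
proof -
  have dem: "0 \<le> demand I i j" if "i < num_fac I" "j < num_cl I" for i j
    using inst that by (simp add: ccfl_instance_def)
  have n: "0 < num_cl I" using inst by (simp add: ccfl_instance_def)
  have x_le_w: "x i j \<le> \<Gamma> * w_til I \<Gamma> x i"
    if "(\<Gamma>, x) \<in> set ts" "i < num_fac I" "j < num_cl I" for \<Gamma> x i j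
  proof -
    have "x i j \<le> (MAX j\<in>{..<num_cl I}. x i j)" using that by (intro Max_ge) auto
    thus ?thesis using valid(1)[OF that(1)] by (simp add: w_til_def)
  qed
  have w: "0 \<le> \<Gamma> * w_til I \<Gamma> x i" if "(\<Gamma>, x) \<in> set ts" "i < num_fac I" for \<Gamma> x i
    using x_le_w[OF that n] valid(2)[OF that n] by linarith
  have v_eq: "Z * (\<Gamma> * v_til I Z \<Gamma> x i) = (\<Sum>j<num_cl I. demand I i j * x i j)"
    if "(\<Gamma>, x) \<in> set ts" for \<Gamma> x i
    using valid(1)[OF that] Z by (simp add: v_til_def)
  have v: "0 \<le> \<Gamma> * v_til I Z \<Gamma> x i" if "(\<Gamma>, x) \<in> set ts" "i < num_fac I" for \<Gamma> x i
  proof -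
    have "0 \<le> Z * (\<Gamma> * v_til I Z \<Gamma> x i)"
      unfolding v_eq[OF that(1)] using that dem valid(2) by (intro sum_nonneg mult_nonneg_nonneg) auto
    thus ?thesis using Z by (simp add: zero_le_mult_iff)
  qed
  show ?thesis
    unfolding lp1_feasible_def
  proof (intro conjI allI impI)
    fix j assume j: "j < num_cl I"
    then obtain \<Gamma> x where t: "(\<Gamma>, x) \<in> set ts" "1 \<le> (\<Sum>i<num_fac I. x i j)" using served by blast
    note t(2)
    also have "(\<Sum>i<num_fac I. x i j) \<le> (\<Sum>(\<Gamma>, x)\<leftarrow>ts. \<Sum>i<num_fac I. x i j)"
      using member_le_sum_list_map[OF t(1), of "\<lambda>(\<Gamma>, x). \<Sum>i<num_fac I. x i j"] j valid(2)
      by (fastforce intro: sum_nonneg)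
    also have "\<dots> = (\<Sum>i<num_fac I. sol_x ts i j)"
      by (simp add: sol_x_def sum_sum_list_commute case_prod_unfold)
    finally show "1 \<le> (\<Sum>i<num_fac I. sol_x ts i j)" .
  next
    fix i j assume ij: "i < num_fac I" "j < num_cl I"
    show "sol_x ts i j \<le> sol_y I Z ts i"
      unfolding sol_x_def sol_y_def y_til_def using x_le_w[OF _ ij] v[OF _ ij(1)]
      by (intro sum_list_mono) (fastforce simp: distrib_left)
    show "0 \<le> sol_x ts i j"
      unfolding sol_x_def using valid(2)[OF _ ij] by (intro sum_list_nonneg) auto
    show "sol_x ts i j = 0" if "i \<notin> near I Z j"
    proof -
      have "map (\<lambda>(\<Gamma>, x). x i j) ts = map (\<lambda>_. 0) ts"
        using valid(3)[OF _ ij that] by (intro map_cong) auto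
      thus ?thesis unfolding sol_x_def by (simp only: sum_list_0)
    qed
  next
    fix i assume i: "i < num_fac I"
    have "(\<Sum>j<num_cl I. demand I i j * sol_x ts i j)
        = (\<Sum>(\<Gamma>, x)\<leftarrow>ts. \<Sum>j<num_cl I. demand I i j * x i j)"
      by (simp add: sol_x_def sum_list_const_mult case_prod_unfold flip: sum_sum_list_commute)
    also have "\<dots> \<le> (\<Sum>(\<Gamma>, x)\<leftarrow>ts. Z * (\<Gamma> * y_til I Z \<Gamma> x i))"
      unfolding y_til_def using w[OF _ i] Z
      by (intro sum_list_mono) (auto simp: distrib_left v_eq)
    also have "\<dots> = Z * sol_y I Z ts i"
      by (simp add: sol_y_def sum_list_const_mult case_prod_unfold)
    finally show "(\<Sum>j<num_cl I. demand I i j * sol_x ts i j) \<le> Z * sol_y I Z ts i" .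
    have "y_til I Z \<Gamma> x i \<le> l_til I Z \<Gamma> x" for \<Gamma> x
      unfolding l_til_def using i by (intro Max_ge) auto
    hence "sol_y I Z ts i \<le> (\<Sum>(\<Gamma>, x)\<leftarrow>ts. \<Gamma> * l_til I Z \<Gamma> x)"
      unfolding sol_y_def using valid(1)
      by (intro sum_list_mono) (fastforce intro: mult_left_mono)
    thus "sol_y I Z ts i \<le> sol_l I Z ts" by (simp add: sol_l_def)
    show "0 \<le> sol_y I Z ts i"
      unfolding sol_y_def y_til_def using w[OF _ i] v[OF _ i]
      by (intro sum_list_nonneg) (fastforce simp: distrib_left)
  qed (simp add: sol_l_def)
qed

text \<open>Here \<open>T \<ge> 1\<close>, so the parameters add up to at most \<open>4 * T\<close>,
  and \<open>log_emn I\<close> is at most twice \<open>ln (m n)\<close>. The constant is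
  \<open>16 * 2 * 4 * 255\<close>.\<close>

lemma doubling_spec:
  assumes inst: "ccfl_instance I" and Z: "0 < Z" and feasible: "lp1_feasible I Z xs ys ls"
  shows "\<exists>ts. doubling I Z = Some ts \<and>
    lp1_feasible I Z (sol_x ts) (sol_y I Z ts) (sol_l I Z ts) \<and>
    cumulative_cost I Z ts \<le> 32640 * (ln (real (num_fac I) * real (num_cl I))
      * ln (real (num_fac I) * real (num_cl I) * rho I)) * lp1_objective I Z xs ys ls"
proof -
  interpret trial I Z 1 xs ys ls using inst Z feasible by unfold_locales auto
  define T where "T = 255 * L * obj / Z"
  obtain k where "T < 2 ^ k" using real_arch_pow[of 2 T] by auto
  hence k: "T < 1 * 2 ^ k" by simp
  have "\<exists>ts. trials_from I Z 1 [0..<n] = Some ts \<and>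
    (\<forall>(\<Gamma>', x)\<in>set ts. 1 \<le> \<Gamma>' \<and> (\<forall>i<m. \<forall>j<n. 0 \<le> x i j \<and> (i \<notin> near I Z j \<longrightarrow> x i j = 0))) \<and>
    (\<forall>j\<in>set [0..<n]. \<exists>(\<Gamma>', x)\<in>set ts. 1 \<le> (\<Sum>i<m. x i j)) \<and>
    cumulative_cost I Z ts \<le> 16 * Z * log_emn I * max 1 (4 * T - 1)"
    unfolding T_def
    by (rule trials_from_spec[OF inst Z feasible _ _ _ k[unfolded T_def]]) auto
  then obtain ts where ts: "trials_from I Z 1 [0..<n] = Some ts"
    "\<forall>(\<Gamma>', x)\<in>set ts. 1 \<le> \<Gamma>' \<and> (\<forall>i<m. \<forall>j<n. 0 \<le> x i j \<and> (i \<notin> near I Z j \<longrightarrow> x i j = 0))"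
    "\<forall>j\<in>set [0..<n]. \<exists>(\<Gamma>', x)\<in>set ts. 1 \<le> (\<Sum>i<m. x i j)"
    "cumulative_cost I Z ts \<le> 16 * Z * log_emn I * max 1 (4 * T - 1)"
    by (elim exE conjE) (rule that)
  have "1 * Z \<le> L * obj" using L_ge_1 obj_ge Z by (intro mult_mono) auto
  hence "1 \<le> T" using Z by (simp add: T_def field_simps)
  note ts(4)
  also have "16 * Z * log_emn I * max 1 (4 * T - 1) \<le> 16 * Z * (2 * ln (real m * real n)) * (4 * T)"
    using \<open>1 \<le> T\<close> Z ln_size_ge_1 log_emn_eq by (intro mult_mono) auto
  also have "\<dots> = 32640 * (ln (real m * real n) * L) * obj"
    using Z by (simp add: T_def)
  finally have "cumulative_cost I Z ts \<le> \<dots>" .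
  moreover have "lp1_feasible I Z (sol_x ts) (sol_y I Z ts) (sol_l I Z ts)"
    by (rule combined_solution_feasible[OF inst Z]) (use ts(2,3) in fastforce)+
  ultimately show ?thesis using ts(1) by (auto simp: doubling_def)
qed

theorem theorem29:
  shows "\<exists>C>0. \<forall>(I :: ccfl) (Z :: real).
    ccfl_instance I \<and> Z > 0 \<and> (\<exists>x y l. lp1_feasible I Z x y l) \<longrightarrow>
    (\<exists>ts. doubling I Z = Some ts \<and>
      lp1_feasible I Z (sol_x ts) (sol_y I Z ts) (sol_l I Z ts) \<and>
      cumulative_cost I Z ts
        \<le> C * (ln (real (num_fac I) * real (num_cl I))
             * ln (real (num_fac I) * real (num_cl I) * rho I)) * opt1 I Z)"
proof (intro exI[of _ 32640] conjI allI impI)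
  fix I :: ccfl and Z :: real
  assume "ccfl_instance I \<and> Z > 0 \<and> (\<exists>x y l. lp1_feasible I Z x y l)"
  then obtain x y l where inst: "ccfl_instance I" and Z: "0 < Z" and feas: "lp1_feasible I Z x y l"
    by blast
  define K where "K = 32640 * (ln (real (num_fac I) * real (num_cl I))
      * ln (real (num_fac I) * real (num_cl I) * rho I))"
  interpret trial I Z 1 x y l using inst Z feas by unfold_locales auto
  have K: "0 < K" using ln_size_ge_1 L_ge_1 by (simp add: K_def)
  from doubling_spec[OF inst Z feas] obtain ts where ts: "doubling I Z = Some ts"
    "lp1_feasible I Z (sol_x ts) (sol_y I Z ts) (sol_l I Z ts)" by blast
  \<comment> \<open>\<open>doubling\<close> is a function, so the same \<open>ts\<close> obeys the
    bound for every feasible solution; dividing by \<open>K > 0\<close> yields a lower bound on all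
    objective values.\<close>
  have "cumulative_cost I Z ts / K \<le> opt1 I Z"
    unfolding opt1_def
  proof (rule cInf_greatest)
    fix b assume "b \<in> {lp1_objective I Z x y l |x y l. lp1_feasible I Z x y l}"
    then obtain x' y' l' where b: "b = lp1_objective I Z x' y' l'" "lp1_feasible I Z x' y' l'" by blast
    have "cumulative_cost I Z ts \<le> K * b"
      using doubling_spec[OF inst Z b(2)] ts(1) by (simp add: b(1) K_def)
    thus "cumulative_cost I Z ts / K \<le> b" using K by (simp add: divide_le_eq mult.commute)
  qed (use feas in blast)
  hence "cumulative_cost I Z ts \<le> K * opt1 I Z" using K by (simp add: divide_le_eq mult.commute)
  thus "\<exists>ts. doubling I Z = Some ts \<and>
      lp1_feasible I Z (sol_x ts) (sol_y I Z ts) (sol_l I Z ts) \<and>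
      cumulative_cost I Z ts \<le> 32640 * (ln (real (num_fac I) * real (num_cl I))
             * ln (real (num_fac I) * real (num_cl I) * rho I)) * opt1 I Z"
    using ts by (auto simp: K_def)
qed simp

end
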